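(* Let $K=\mathbb{Q}(q)$ be the field of rational functions in $q$ over $\mathbb{Q}$, and let $a(T)\in K$ be the coefficient of the generic planar tree exponential series $EXP$ relative to $T\in\mathbf{PRT}'$. Then for all $V,W\in\mathbf{PRT}'$, $$a(V)\cdot a(W)=\sum_{T\in\mathbf{PRT}'}a(T)\,c_T(V\sqcup\!\sqcup W).$$
   Context: Trees. A finite planar rooted tree is a (nonempty) finite tree $T$ with a root $\rho_T$ and a linear (left-to-right) order on the set of children of each vertex. The arity of a vertex is the number of its children, and $ar(T)$ is the arity of the root; $T$ is reduced if no vertex has arity $1$. $\mathbf{PRT}$ is the set of isomorphism classes of finite planar reduced rooted trees, $\mathbf{PRT}'=\{1\}\,\dot\cup\,\mathbf{PRT}$ with $1$ the empty tree, and $x\in\mathbf{PRT}$ is the tree with a single vertex. $L(T)$ is the set of leaves (vertices of arity $0$) of $T$ ($L(1)=\emptyset$) and $\deg(T)$ is the number of leaves. For $m\ge2$ the $m$-ary grafting $T_1\cdot T_2\cdots T_m$ of trees in $\mathbf{PRT}$ adds a new root whose children are, in order, the roots of $T_1,\dots,T_m$. $K\{x\}_\infty$ is the $K$-vector space with basis $\mathbf{PRT}'$, and $c_T:K\{x\}_\infty\to K$ is the $K$-linear map with $c_T(S)=\delta_{ST}$ for $S\in\mathbf{PRT}'$. Generic exponential. $EXP=\sum_{T\in\mathbf{PRT}'}a(T)\,T$, where $a(1)=a(x)=1$ and recursively $$a(T)=\frac{\binom{q}{m}}{q^n-q}\,a(T_1)\cdots a(T_m)$$ if $m=ar(T)\ge2$,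 $T=T_1\cdot T_2\cdots T_m$ ($T_i\in\mathbf{PRT}$) and $n=\deg(T)$; here $\binom{q}{m}=\frac{q(q-1)\cdots(q-m+1)}{m!}$. Shuffle product. For vertices $a,b$ of a finite planar rooted tree $T$, $[a,b]_T$ denotes the simple path between them. $\mathrm{Red}(T)$ is the planar reduced rooted tree whose vertices are the vertices of $T$ of arity $\neq1$, whose edges are the pairs $\{a,b\}$ of distinct such vertices for which $[a,b]_T$ contains no vertex of arity $\ne1$ other than $a,b$, whose root is the vertex of arity $\neq1$ closest to $\rho_T$, and whose left-to-right orders are induced from $T$. For $I\subseteq L(T)$ let $T_I:=\bigcup_{a\in I}[a,\rho_T]_T$, a planar rooted tree with root $\rho_T$, and $T|I:=\mathrm{Red}(T_I)$, with $T|\emptyset=1$. For $V,W,T\in\mathbf{PRT}'$ let $N_{V,W}(T):=\{I\subseteq L(T):T|I=V,\ T|(L(T)-I)=W\}$ and $V\sqcup\!\sqcup W:=\sum_{T\in\mathbf{PRT}'}\sharp N_{V,W}(T)\cdot T\in K\{x\}_\infty$ (a finite sum), $\sharp$ denoting cardinality. *)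

theory Defs
  imports
    "HOL-Library.Poly_Mapping"
    "HOL-Computational_Algebra.Polynomial"
    "HOL-Computational_Algebra.Fraction_Field"
begin

section \<open>Planar rooted trees as graphs\<close>

text \<open>
  The pair \<open>(a, b)\<close> belongs to \<open>left_of T\<close> iff \<open>a\<close> and \<open>b\<close> are children of the same vertex and
  \<open>a\<close> is strictly to the left of \<open>b\<close>.
  The definitions below are meant for records that are finite trees in the sense of graph theory.
\<close>

record 'v planar_tree =
  verts :: "'v set"
  edges :: "'v set set"
  root :: 'v
  left_of :: "('v \<times> 'v) set"

definition simple_path :: "'v planar_tree \<Rightarrow> 'v list \<Rightarrow> bool" where
  "simple_path T p \<longleftrightarrow> p \<noteq> [] \<and> distinct p \<and> set p \<subseteq> verts T \<and>
     (\<forall>i. Suc i < length p \<longrightarrow> {p ! i, p ! Suc i} \<in> edges T)"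

text \<open>The vertices of $[a,b]_T$; in a tree there is exactly one simple path from \<open>a\<close> to \<open>b\<close>.\<close>

definition path :: "'v planar_tree \<Rightarrow> 'v \<Rightarrow> 'v \<Rightarrow> 'v set" where
  "path T a b = {v. \<exists>p. simple_path T p \<and> hd p = a \<and> last p = b \<and> v \<in> set p}"

definition children :: "'v planar_tree \<Rightarrow> 'v \<Rightarrow> 'v set" where
  "children T v = {w \<in> verts T. {v, w} \<in> edges T \<and> v \<in> path T w (root T)}"

definition arity :: "'v planar_tree \<Rightarrow> 'v \<Rightarrow> nat" where
  "arity T v = card (children T v)"

definition leaves :: "'v planar_tree \<Rightarrow> 'v set" where
  "leaves T = {v \<in> verts T. arity T v = 0}"

text \<open>
  In \<open>Red\<close>, the root is the vertex of arity different from 1 with the shortest path to the root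
  of \<open>T\<close>. Two vertices \<open>b\<close>, \<open>c\<close> hanging below the same vertex \<open>a\<close> are ordered like the
  children \<open>b'\<close>, \<open>c'\<close> of \<open>a\<close> in \<open>T\<close> through which they are reached from \<open>a\<close>.
\<close>

definition Red :: "'v planar_tree \<Rightarrow> 'v planar_tree" where
  "Red T =
    (let R = {v \<in> verts T. arity T v \<noteq> 1};
         E = {{a, b} | a b. a \<in> R \<and> b \<in> R \<and> a \<noteq> b \<and> path T a b \<inter> R = {a, b}}
     in \<lparr>verts = R,
         edges = E,
         root = (ARG_MIN (\<lambda>v. card (path T v (root T))) v. v \<in> R),
         left_of = {(b, c). \<exists>a\<in>R. {a, b} \<in> E \<and> {a, c} \<in> E \<and>
           (\<exists>b' \<in> path T a b \<inter> children T a. \<exists>c' \<in> path T a c \<inter> children T a.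
              (b', c') \<in> left_of T)}\<rparr>)"

text \<open>The tree $T_I$, for nonempty \<open>I\<close>.\<close>

definition span_tree :: "'v planar_tree \<Rightarrow> 'v set \<Rightarrow> 'v planar_tree" where
  "span_tree T I =
    (let S = (\<Union>a\<in>I. path T a (root T))
     in \<lparr>verts = S,
         edges = {e \<in> edges T. \<exists>a\<in>I. e \<subseteq> path T a (root T)},
         root = root T,
         left_of = left_of T \<inter> S \<times> S\<rparr>)"

definition iso :: "'v planar_tree \<Rightarrow> 'w planar_tree \<Rightarrow> bool" (infix "\<cong>" 50) where
  "S \<cong> T \<longleftrightarrow> (\<exists>f. bij_betw f (verts S) (verts T) \<and> f (root S) = root T \<and>
     (\<forall>a\<in>verts S. \<forall>b\<in>verts S.
        ({a, b} \<in> edges S \<longleftrightarrow> {f a, f b} \<in> edges T) \<and>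
        ((a, b) \<in> left_of S \<longleftrightarrow> (f a, f b) \<in> left_of T)))"


section \<open>Isomorphism classes of planar reduced rooted trees\<close>

text \<open>
  A planar reduced rooted tree is, up to isomorphism, either a single vertex (\<open>Leaf\<close>, the
  tree $x$) or in a unique way a grafting $T_1\cdot T_2\cdots T_m$ with $m\ge 2$;
  \<open>Graft T1 T2 [T3, ..., Tm]\<close> is that grafting. The type \<open>prt\<close> is thus the set
  $\mathbf{PRT}$, and \<open>prt option\<close> is $\mathbf{PRT}'$, with \<open>None\<close> the empty tree $1$.
\<close>

datatype prt = Leaf | Graft prt prt "prt list"

fun subtrees :: "prt \<Rightarrow> prt list" where
  "subtrees Leaf = []"
| "subtrees (Graft T1 T2 Ts) = T1 # T2 # Ts"

text \<open>
  A representative of the isomorphism class: a vertex is the list of the (0-based) positions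
  among siblings that lead to it from the root.
\<close>

inductive address :: "prt \<Rightarrow> nat list \<Rightarrow> bool" where
  "address T []"
| "i < length (subtrees T) \<Longrightarrow> address (subtrees T ! i) p \<Longrightarrow> address T (i # p)"

definition graph :: "prt \<Rightarrow> nat list planar_tree" where
  "graph T = \<lparr>verts = {p. address T p},
     edges = {{p, p @ [i]} | p i. address T (p @ [i])},
     root = [],
     left_of = {(p @ [i], p @ [j]) | p i j.
       i < j \<and> address T (p @ [i]) \<and> address T (p @ [j])}\<rparr>"

definition deg :: "prt \<Rightarrow> nat" where
  "deg T = card (leaves (graph T))"

definition leaf_set :: "prt option \<Rightarrow> nat list set" where
  "leaf_set T = (case T of None \<Rightarrow> {} | Some t \<Rightarrow> leaves (graph t))"


section \<open>The generic exponential\<close>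

type_synonym ratfun = "rat poly fract"

definition q :: ratfun where
  "q = Fract [:0, 1:] 1"

fun exp_coeff_prt :: "prt \<Rightarrow> ratfun" where
  "exp_coeff_prt Leaf = 1"
| "exp_coeff_prt (Graft T1 T2 Ts) =
     (q gchoose length (T1 # T2 # Ts)) / (q ^ deg (Graft T1 T2 Ts) - q) *
     prod_list (map exp_coeff_prt (T1 # T2 # Ts))"

text \<open>\<open>exp_coeff T\<close> is the coefficient $a(T)$ of \<open>T\<close> in $EXP$.\<close>

definition exp_coeff :: "prt option \<Rightarrow> ratfun" where
  "exp_coeff T = (case T of None \<Rightarrow> 1 | Some t \<Rightarrow> exp_coeff_prt t)"


section \<open>The shuffle product\<close>

text \<open>\<open>restricts_to T I V\<close> expresses $T|I = V$, an equality of isomorphism classes.\<close>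

definition restricts_to :: "prt option \<Rightarrow> nat list set \<Rightarrow> prt option \<Rightarrow> bool" where
  "restricts_to T I V \<longleftrightarrow>
     (if I = {} then V = None
      else \<exists>t v. T = Some t \<and> V = Some v \<and> Red (span_tree (graph t) I) \<cong> graph v)"

definition N :: "prt option \<Rightarrow> prt option \<Rightarrow> prt option \<Rightarrow> nat list set set" where
  "N V W T = {I. I \<subseteq> leaf_set T \<and> restricts_to T I V \<and> restricts_to T (leaf_set T - I) W}"

text \<open>
  The space $K\{x\}_\infty$ consists of the finitely supported functions on $\mathbf{PRT}'$.
  The sum defining the shuffle product has finitely many nonzero terms, since all trees
  occurring in it have \<open>deg V + deg W\<close> leaves.
\<close>

type_synonym tree_space = "prt option \<Rightarrow>\<^sub>0 ratfun"

definition coeff_at :: "prt option \<Rightarrow> tree_space \<Rightarrow> ratfun" where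
  "coeff_at T f = Poly_Mapping.lookup f T"

definition shuffle :: "prt option \<Rightarrow> prt option \<Rightarrow> tree_space" where
  "shuffle V W = (\<Sum>T. Poly_Mapping.single T (of_nat (card (N V W T))))"

end

theory Submission
  imports
    Defs
    "HOL-Library.Sublist"
    "HOL-Computational_Algebra.Formal_Power_Series"
begin

text \<open>
  Restricting a grafting to a set of leaves restricts the branches and grafts the nonempty
  results, so the shuffle coproduct \<open>T \<mapsto> \<Sum> (T|I) \<otimes> (T|(L(T) - I))\<close> is multiplicative for all
  graftings. The recursion for \<open>a\<close> says $EXP(q x) = \sum_m \binom{q}{m} (EXP(x) - 1)^{\cdot m}$.
  Applying the coproduct, the sums $b(V, W) = \sum_T a(T) c_T(V \sqcup\!\sqcup W)$ satisfy, with
  $n = \deg V + \deg W$, a recursion expressing $(q^n - q) b(V, W)$ through smaller pairs. The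
  products $a(V) a(W)$ satisfy the same recursion: expanding
  $q^{\deg V} a(V) \cdot q^{\deg W} a(W)$ this amounts to
  $\binom{q}{k} \binom{q}{l} = \sum_m \binom{q}{m} c(m, k, l)$, where $c(m, k, l)$ is the number
  of pairs of subsets of sizes \<open>k\<close> and \<open>l\<close> that cover \<open>{1..m}\<close>.
\<close>


section \<open>Trees of addresses and their reductions\<close>

text \<open>The statement speaks of paths, arities and isomorphism of graphs, whereas the recursion
  for a(T) speaks of branches. The bridge is that on sets of addresses the outcome of
  \<open>Red\<close> depends only on two relations, being a prefix and branching off to the left, so
  a bijection respecting both is an isomorphism of reduced trees. An isomorphism between
  representatives of planar trees fixes every address; hence T|I is one definite tree, and a
  recursion along branches computes it. Two points shape the algebra. A branch has at least one
  leaf, so its two complementary restrictions are never both empty; this is why covering pairs of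
  subsets are counted. And the term m = 1 of the binomial sum involves the pair (V, W) itself; moved
  to the other side it accounts for the -q in q^n - q. This factor is nonzero for n \<ge> 2 because
  q is an indeterminate, but it vanishes for n = 1, so total degree 1 is settled directly.\<close>

definition addr_graph :: "nat list set \<Rightarrow> nat list planar_tree" where
  "addr_graph P = \<lparr>verts = P,
     edges = {{p, p @ [i]} | p i. p @ [i] \<in> P},
     root = [],
     left_of = {(p @ [i], p @ [j]) | p i j. i < j \<and> p @ [i] \<in> P \<and> p @ [j] \<in> P}\<rparr>"

lemma addr_graph_simps [simp]:
  "verts (addr_graph P) = P" "root (addr_graph P) = []"
  by (simp_all add: addr_graph_def)

lemma edges_addr_graph:
  "{u, v} \<in> edges (addr_graph P) \<longleftrightarrow> (\<exists>i. v = u @ [i] \<and> v \<in> P) \<or> (\<exists>i. u = v @ [i] \<and> u \<in> P)"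
  by (auto simp: addr_graph_def doubleton_eq_iff)

lemma left_of_addr_graph:
  "(u, v) \<in> left_of (addr_graph P) \<longleftrightarrow>
     (\<exists>p i j. u = p @ [i] \<and> v = p @ [j] \<and> i < j \<and> u \<in> P \<and> v \<in> P)"
  by (auto simp: addr_graph_def)

definition prefix_closed :: "'a list set \<Rightarrow> bool" where
  "prefix_closed P \<longleftrightarrow> (\<forall>b\<in>P. \<forall>a. prefix a b \<longrightarrow> a \<in> P)"

lemma prefix_closedD: "prefix_closed P \<Longrightarrow> b \<in> P \<Longrightarrow> prefix a b \<Longrightarrow> a \<in> P"
  by (auto simp: prefix_closed_def)

section \<open>Simple paths between addresses of a prefix-closed set\<close>

lemma simple_path_iff:
  "simple_path T p \<longleftrightarrow> p \<noteq> [] \<and> distinct p \<and> set p \<subseteq> verts T \<and>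
     successively (\<lambda>u v. {u, v} \<in> edges T) p"
  by (auto simp: simple_path_def successively_conv_nth)

lemma path_commute: "path T a b = path T b a"
proof -
  have "path T a b \<subseteq> path T b a" for a b
  proof
    fix v assume "v \<in> path T a b"
    then obtain p where p: "simple_path T p" "hd p = a" "last p = b" "v \<in> set p"
      by (auto simp: path_def)
    then have "simple_path T (rev p)"
      by (auto simp: simple_path_iff insert_commute)
    moreover have "hd (rev p) = b" "last (rev p) = a"
      using p by (auto simp: simple_path_def hd_rev last_rev)
    ultimately show "v \<in> path T b a"
      using p by (auto simp: path_def intro!: exI[of _ "rev p"])
  qed
  then show ?thesis by blast
qed

text \<open>The edge from \<open>d @ [i]\<close> to \<open>d\<close> is the only one connecting the
  extensions of \<open>d @ [i]\<close> with the other addresses, so a walk that gets out must step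
  onto \<open>d\<close>.\<close>

lemma walk_leaves_subtree:
  assumes "successively (\<lambda>u v. {u, v} \<in> edges (addr_graph P)) xs" "xs \<noteq> []"
    "prefix (d @ [i]) (hd xs)" "\<not> prefix (d @ [i]) (last xs)"
  shows "d \<in> set xs"
  using assms
proof (induction xs)
  case (Cons x xs)
  then obtain y ys where xs: "xs = y # ys" by (cases xs) auto
  show ?case
  proof (cases "prefix (d @ [i]) y")
    case True
    then show ?thesis using Cons xs by auto
  next
    case False
    have "(\<exists>j. y = x @ [j]) \<or> (\<exists>j. x = y @ [j])"
      using Cons.prems(1) xs by (auto simp: edges_addr_graph)
    then show ?thesis using False Cons.prems(3) xs by (auto simp: prefix_snoc)
  qed
qed simp

text \<open>A simple path descending to an ancestor can never step down: it would have to come back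
  through the vertex it just left.\<close>

lemma set_path_to_prefix:
  assumes "successively (\<lambda>u v. {u, v} \<in> edges (addr_graph P)) xs" "distinct xs" "xs \<noteq> []"
    "prefix (last xs) (hd xs)"
  shows "set xs = {v. prefix (last xs) v \<and> prefix v (hd xs)}"
  using assms
proof (induction xs rule: induct_list012)
  case (2 x)
  then show ?case by (auto intro: prefix_order.antisym)
next
  case (3 x y ys)
  let ?a = "last (y # ys)"
  have ax: "prefix ?a x" "?a \<noteq> x" using 3 by (auto split: if_splits)
  have "(\<exists>j. y = x @ [j]) \<or> (\<exists>j. x = y @ [j])"
    using "3.prems"(1) by (auto simp: edges_addr_graph)
  moreover have False if "y = x @ [j]" for j
  proof -
    have "x \<in> set (y # ys)"
      by (rule walk_leaves_subtree[of P _ _ j])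
        (use "3.prems"(1) that ax in \<open>auto simp: prefix_def\<close>)
    then show False using "3.prems"(2) by auto
  qed
  ultimately obtain j where j: "x = y @ [j]" by blast
  have "prefix ?a y" using ax j by (auto simp: prefix_snoc)
  with 3 have "set (y # ys) = {v. prefix ?a v \<and> prefix v y}" by auto
  then show ?case using j ax by (auto simp: prefix_snoc)
qed simp

lemma exists_path_to_prefix:
  assumes "prefix_closed P" "b \<in> P" "prefix a b"
  obtains xs where "simple_path (addr_graph P) xs" "hd xs = b" "last xs = a"
    "set xs = {v. prefix a v \<and> prefix v b}"
proof -
  have "\<exists>xs. simple_path (addr_graph P) xs \<and> hd xs = b \<and> last xs = a \<and>
     set xs = {v. prefix a v \<and> prefix v b}"
    using assms(2,3)
  proof (induction b rule: rev_induct)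
    case Nil
    then show ?case by (intro exI[of _ "[[]]"]) (auto simp: simple_path_iff)
  next
    case (snoc i b)
    show ?case
    proof (cases "a = b @ [i]")
      case True
      then show ?thesis
        using snoc by (intro exI[of _ "[a]"]) (auto simp: simple_path_iff intro: prefix_order.antisym)
    next
      case False
      then have ab: "prefix a b" using snoc by (auto simp: prefix_snoc)
      moreover have "b \<in> P" using assms(1) snoc by (auto simp: prefix_closed_def)
      ultimately obtain xs where xs: "simple_path (addr_graph P) xs" "hd xs = b" "last xs = a"
        "set xs = {v. prefix a v \<and> prefix v b}" using snoc by blast
      then have "simple_path (addr_graph P) ((b @ [i]) # xs)"
        using snoc by (cases xs) (auto simp: simple_path_iff edges_addr_graph)
      then show ?thesis using xs ab
        by (intro exI[of _ "(b @ [i]) # xs"]) (auto simp: simple_path_iff prefix_snoc)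
    qed
  qed
  then show ?thesis using that by blast
qed

lemma path_to_prefix:
  assumes "prefix_closed P" "b \<in> P" "prefix a b"
  shows "path (addr_graph P) b a = {v. prefix a v \<and> prefix v b}"
proof
  show "path (addr_graph P) b a \<subseteq> {v. prefix a v \<and> prefix v b}"
    using set_path_to_prefix assms(3) by (fastforce simp: path_def simple_path_iff)
  show "{v. prefix a v \<and> prefix v b} \<subseteq> path (addr_graph P) b a"
    using exists_path_to_prefix[OF assms] unfolding path_def by blast
qed

text \<open>Climbing from \<open>u\<close> to \<open>a\<close> and descending to \<open>v\<close>
  gives a simple path, since the two legs share only \<open>a\<close>. This is what prevents
  incomparable vertices from being adjacent after reduction.\<close>

lemma meet_in_path:
  assumes P: "prefix_closed P" and uv: "u \<in> P" "v \<in> P"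
    and a: "prefix (a @ [i]) u" "prefix (a @ [j]) v" "i \<noteq> j"
  shows "a \<in> path (addr_graph P) u v"
proof -
  have au: "prefix a u" "prefix a v" using a append_prefixD by blast+
  obtain xs where xs: "simple_path (addr_graph P) xs" "hd xs = u" "last xs = a"
    "set xs = {w. prefix a w \<and> prefix w u}"
    by (rule exists_path_to_prefix[OF P uv(1) au(1)])
  obtain ys where ys: "simple_path (addr_graph P) ys" "hd ys = v" "last ys = a"
    "set ys = {w. prefix a w \<and> prefix w v}"
    by (rule exists_path_to_prefix[OF P uv(2) au(2)])
  \<comment> \<open>The second leg loses its endpoint \<open>a\<close>, which would otherwise occur
    twice in the concatenation.\<close>
  obtain zs where zs: "ys = zs @ [a]"
    using ys by (metis append_butlast_last_id simple_path_def)
  have "zs \<noteq> []" using zs ys a by (auto simp: prefix_def)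
  have "w = a" if "prefix a w" "prefix w u" "prefix w v" for w
  proof (rule ccontr)
    assume "w \<noteq> a"
    then obtain k where "prefix (a @ [k]) w"
      using \<open>prefix a w\<close> by (metis append_one_prefix prefix_length_less strict_prefixI)
    then have "prefix (a @ [k]) u" "prefix (a @ [k]) v" using that by auto
    then have "k = i" "k = j" using a by (auto simp: prefix_def)
    then show False using a by simp
  qed
  then have "set xs \<inter> set ys \<subseteq> {a}" using xs ys by auto
  then have disj: "set xs \<inter> set zs = {}" using zs ys by (auto simp: simple_path_iff)
  have "simple_path (addr_graph P) (xs @ rev zs)"
    using xs(1,3) ys(1) disj zs \<open>zs \<noteq> []\<close>
    by (auto simp: simple_path_iff successively_append_iff insert_commute hd_rev)
  moreover have "hd (xs @ rev zs) = u" "last (xs @ rev zs) = v"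
    using xs ys zs \<open>zs \<noteq> []\<close> by (auto simp: simple_path_iff last_rev)
  moreover have "a \<in> set (xs @ rev zs)" using xs au by auto
  ultimately show ?thesis unfolding path_def by blast
qed

section \<open>Arities and reduction in terms of the prefix order\<close>

lemma children_addr_graph:
  assumes "prefix_closed P"
  shows "children (addr_graph P) v = {v @ [i] | i. v @ [i] \<in> P}"
proof -
  have "path (addr_graph P) w [] = {v. prefix v w}" if "w \<in> P" for w
    using path_to_prefix[OF assms that] by simp
  then show ?thesis
    by (auto simp: children_def edges_addr_graph)
qed

text \<open>The vertices that \<open>Red\<close> keeps; leaves are among them, as their number of
  children is 0.\<close>

definition branching :: "nat list set \<Rightarrow> nat list set" where
  "branching P = {v \<in> P. card {i. v @ [i] \<in> P} \<noteq> 1}"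

lemma arity_addr_graph:
  assumes "prefix_closed P"
  shows "arity (addr_graph P) v = card {i. v @ [i] \<in> P}"
proof -
  have "children (addr_graph P) v = (\<lambda>i. v @ [i]) ` {i. v @ [i] \<in> P}"
    using children_addr_graph[OF assms] by auto
  then show ?thesis by (simp add: arity_def card_image inj_on_def)
qed

text \<open>Two different children rule out arity 1. So the kept vertices are closed under meets,
  which gives the reduction a least vertex.\<close>

lemma meet_in_branching:
  assumes "prefix_closed P" "u \<in> P" "v \<in> P" "prefix (a @ [i]) u" "prefix (a @ [j]) v" "i \<noteq> j"
  shows "a \<in> branching P"
proof -
  have *: "a @ [i] \<in> P" "a @ [j] \<in> P" using assms by (auto intro: prefix_closedD)
  then have "a \<in> P" using assms(1) by (auto intro: prefix_closedD)
  moreover have "card {k. a @ [k] \<in> P} \<noteq> 1"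
  proof
    assume "card {k. a @ [k] \<in> P} = 1"
    then obtain k where "{k. a @ [k] \<in> P} = {k}" by (rule card_1_singletonE)
    then have "i = k" "j = k" using * by blast+
    then show False using assms(6) by simp
  qed
  ultimately show ?thesis by (simp add: branching_def)
qed

text \<open>Lexicographic comparison in which a prefix and its extensions are unrelated: the
  left-to-right order of incomparable vertices, decided where they part.\<close>

fun left_branch :: "nat list \<Rightarrow> nat list \<Rightarrow> bool" where
  "left_branch (i # p) (j # r) \<longleftrightarrow> i < j \<or> i = j \<and> left_branch p r"
| "left_branch _ _ \<longleftrightarrow> False"

lemma left_branch_iff:
  "left_branch b c \<longleftrightarrow> (\<exists>a i j. i < j \<and> prefix (a @ [i]) b \<and> prefix (a @ [j]) c)"
proof
  show "left_branch b c \<Longrightarrow> \<exists>a i j. i < j \<and> prefix (a @ [i]) b \<and> prefix (a @ [j]) c"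
  proof (induction b c rule: left_branch.induct)
    case (1 i p j r)
    show ?case
    proof (cases "i < j")
      case True
      then show ?thesis by (intro exI[of _ "[]"]) auto
    next
      case False
      then obtain a k l where "k < l" "prefix (a @ [k]) p" "prefix (a @ [l]) r" "i = j"
        using 1 by auto
      then show ?thesis by (intro exI[of _ "i # a"]) auto
    qed
  qed auto
next
  assume "\<exists>a i j. i < j \<and> prefix (a @ [i]) b \<and> prefix (a @ [j]) c"
  then obtain a i j where "i < j" "prefix (a @ [i]) b" "prefix (a @ [j]) c" by blast
  then show "left_branch b c"
    by (induction a arbitrary: b c) (auto simp: prefix_Cons append_eq_Cons_conv elim!: prefixE)
qed

text \<open>Meant for meet-closed \<open>R\<close>; without a least element of \<open>R\<close> the root is junk.\<close>

definition covers :: "nat list set \<Rightarrow> nat list \<Rightarrow> nat list \<Rightarrow> bool" where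
  "covers R a b \<longleftrightarrow> a \<in> R \<and> b \<in> R \<and> strict_prefix a b \<and>
     (\<forall>c\<in>R. prefix a c \<and> prefix c b \<longrightarrow> c = a \<or> c = b)"

definition addr_tree :: "nat list set \<Rightarrow> nat list planar_tree" where
  "addr_tree R = \<lparr>verts = R,
     edges = {{a, b} | a b. covers R a b},
     root = (THE r. r \<in> R \<and> (\<forall>v\<in>R. prefix r v)),
     left_of = {(b, c). left_branch b c \<and> (\<exists>a. covers R a b \<and> covers R a c)}\<rparr>"

lemma edges_addr_tree: "{a, b} \<in> edges (addr_tree R) \<longleftrightarrow> covers R a b \<or> covers R b a"
  by (auto simp: addr_tree_def doubleton_eq_iff)

lemma least_address:
  assumes "r \<in> R" "\<And>v. v \<in> R \<Longrightarrow> prefix r v"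
  shows "(THE r. r \<in> R \<and> (\<forall>v\<in>R. prefix r v)) = r"
  using assms by (intro the_equality) (auto intro: prefix_order.antisym)

lemma not_prefix_branch:
  assumes "\<not> prefix u v" "\<not> prefix v u"
  obtains a i j where "i \<noteq> j" "prefix (a @ [i]) u" "prefix (a @ [j]) v"
  using parallel_decomp[of u v] assms by (metis append.assoc append_Cons append_Nil prefixI parallelI)

lemma card_prefixes: "card {w. prefix w v} = Suc (length v)"
proof -
  have "{w. prefix w v} = set (prefixes v)" by auto
  then show ?thesis by (simp add: distinct_card)
qed

text \<open>Between comparable addresses the path is an interval of the prefix order, so adjacency
  after reduction means that no kept vertex lies strictly between. Between incomparable ones the
  path passes through their meet, which is kept, so they are not adjacent.\<close>

lemma Red_addr_graph:
  assumes P: "prefix_closed P" and "branching P \<noteq> {}"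
  defines "R \<equiv> branching P"
  shows "Red (addr_graph P) = addr_tree R"
proof -
  let ?T = "addr_graph P"
  let ?E = "{{a, b} | a b. a \<in> R \<and> b \<in> R \<and> a \<noteq> b \<and> path ?T a b \<inter> R = {a, b}}"
  define E' where "E' = {{a, b} | a b. covers R a b}"
  have RP: "R \<subseteq> P" by (auto simp: R_def branching_def)
  have R: "{v \<in> verts ?T. arity ?T v \<noteq> 1} = R"
    by (simp add: R_def branching_def arity_addr_graph[OF P])
  have meet: "a \<in> R" if "u \<in> R" "v \<in> R" "prefix (a @ [i]) u" "prefix (a @ [j]) v" "i \<noteq> j"
    for u v a i j
    using meet_in_branching[OF P _ _ that(3-5)] that(1,2) RP by (auto simp: R_def)
  have cov: "path ?T a b \<inter> R = {a, b} \<longleftrightarrow> covers R a b"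
    if "a \<in> R" "b \<in> R" "a \<noteq> b" "prefix a b" for a b
  proof -
    have "path ?T a b = {v. prefix a v \<and> prefix v b}"
      using path_to_prefix[OF P, of b a] that RP path_commute by (metis subsetD)
    then show ?thesis using that by (auto simp: covers_def)
  qed
  have E_iff: "path ?T a b \<inter> R = {a, b} \<longleftrightarrow> covers R a b \<or> covers R b a"
    if ab: "a \<in> R" "b \<in> R" "a \<noteq> b" for a b
  proof -
    consider "prefix a b" | "prefix b a" | "\<not> prefix a b" "\<not> prefix b a" by blast
    then show ?thesis
    proof cases
      case 1
      then show ?thesis using cov[OF ab] by (auto simp: covers_def)
    next
      case 2
      then show ?thesis using cov[of b a] ab path_commute[of ?T a b]
        by (auto simp: covers_def insert_commute)
    next
      case 3
      then obtain d i j where d: "i \<noteq> j" "prefix (d @ [i]) a" "prefix (d @ [j]) b"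
        by (rule not_prefix_branch)
      then have "d \<in> path ?T a b \<inter> R"
        using meet_in_path[OF P _ _ d(2,3,1)] meet[OF _ _ d(2,3,1)] ab RP by blast
      moreover have "d \<noteq> a" "d \<noteq> b" using d 3 by (auto simp: prefix_def)
      ultimately show ?thesis using 3 by (auto simp: covers_def)
    qed
  qed
  have E: "?E = E'"
    unfolding E'_def
  proof (intro Collect_cong iffI; elim exE conjE)
    fix e a b
    assume e: "e = {a, b}" and ab: "a \<in> R" "b \<in> R" "a \<noteq> b" "path ?T a b \<inter> R = {a, b}"
    consider "covers R a b" | "covers R b a" using E_iff[OF ab(1-3)] ab(4) by auto
    then show "\<exists>a b. e = {a, b} \<and> covers R a b"
    proof cases
      case 1
      then show ?thesis using e by (intro exI[of _ a] exI[of _ b]) simp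
    next
      case 2
      then show ?thesis using e by (intro exI[of _ b] exI[of _ a]) (simp add: insert_commute)
    qed
  next
    fix e a b
    assume e: "e = {a, b}" and ab: "covers R a b"
    then have "a \<in> R" "b \<in> R" "a \<noteq> b" by (auto simp: covers_def)
    moreover have "path ?T a b \<inter> R = {a, b}" using E_iff[OF calculation] ab by simp
    ultimately show "\<exists>a b. e = {a, b} \<and> a \<in> R \<and> b \<in> R \<and> a \<noteq> b \<and> path ?T a b \<inter> R = {a, b}"
      using e by (intro exI[of _ a] exI[of _ b]) simp
  qed
  \<comment> \<open>\<open>Red\<close> selects the root by distance from the old root, which here is
    the length of the address.\<close>
  have card_path: "card (path ?T v (root ?T)) = Suc (length v)" if "v \<in> R" for v
    using path_to_prefix[OF P, of v "[]"] that RP card_prefixes by (simp add: subset_iff)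
  define r where "r = (ARG_MIN (\<lambda>v. card (path ?T v (root ?T))) v. v \<in> R)"
  obtain r0 where "r0 \<in> R" using assms(2) by (auto simp: R_def)
  then have rR: "r \<in> R" unfolding r_def by (rule arg_min_natI[of "\<lambda>v. v \<in> R" r0])
  have r_le: "length r \<le> length v" if "v \<in> R" for v
    using arg_min_nat_le[of "\<lambda>v. v \<in> R" v "\<lambda>v. card (path ?T v (root ?T))"]
      that card_path rR unfolding r_def[symmetric] by simp
  \<comment> \<open>If \<open>r\<close> were not a prefix of \<open>v\<close>, both would branch off
    from a kept meet shorter than \<open>r\<close>.\<close>
  have least: "prefix r v" if "v \<in> R" for v
  proof (rule ccontr)
    assume n: "\<not> prefix r v"
    then have "\<not> prefix v r"
      using r_le[OF that] prefix_length_prefix[of r r v] not_equal_is_parallel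
      by (metis le_antisym prefix_length_less prefix_order.order_refl strict_prefixI leD)
    with n obtain a i j where a: "i \<noteq> j" "prefix (a @ [i]) r" "prefix (a @ [j]) v"
      by (rule not_prefix_branch)
    then have "a \<in> R" using meet[OF rR that a(2,3,1)] by blast
    then show False using r_le[of a] prefix_length_le[OF a(2)] by simp
  qed
  have E'_iff: "{a, b} \<in> E' \<longleftrightarrow> covers R a b \<or> covers R b a" for a b
    by (auto simp: E'_def doubleton_eq_iff)
  have pth: "path ?T a b = {v. prefix a v \<and> prefix v b}" if "covers R a b" for a b
    using path_to_prefix[OF P, of b a] that RP path_commute[of ?T a b] by (auto simp: covers_def)
  \<comment> \<open>Edges are unordered pairs, and \<open>left_of\<close> in \<open>Red\<close> does
    not ask that \<open>b\<close> lie below \<open>a\<close>; a child of \<open>a\<close> on the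
    path to \<open>b\<close> forces it.\<close>
  have down: "covers R a b \<and> prefix (a @ [i]) b"
    if "covers R a b \<or> covers R b a" "a @ [i] \<in> path ?T a b" for a b i
    proof -
    have "\<not> covers R b a"
    proof
      assume "covers R b a"
      then have "prefix (a @ [i]) a" using pth[of b a] that(2) path_commute[of ?T a b] by auto
      then show False using prefix_length_le by fastforce
    qed
    then show ?thesis using that pth by auto
  qed
  have L: "(\<exists>a\<in>R. {a, b} \<in> E' \<and> {a, c} \<in> E' \<and>
      (\<exists>b' \<in> path ?T a b \<inter> children ?T a. \<exists>c' \<in> path ?T a c \<inter> children ?T a.
        (b', c') \<in> left_of ?T)) \<longleftrightarrow>
    left_branch b c \<and> (\<exists>a. covers R a b \<and> covers R a c)" (is "?L \<longleftrightarrow> ?L'") for b c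
  proof
    assume ?L
    then obtain a b' c' where a: "{a, b} \<in> E'" "{a, c} \<in> E'"
      and b': "b' \<in> path ?T a b" "b' \<in> children ?T a"
      and c': "c' \<in> path ?T a c" "c' \<in> children ?T a" and l: "(b', c') \<in> left_of ?T"
      by blast
    obtain i where i: "b' = a @ [i]" using b' children_addr_graph[OF P] by auto
    obtain j where j: "c' = a @ [j]" using c' children_addr_graph[OF P] by auto
    have "i < j" using l i j by (auto simp: left_of_addr_graph)
    moreover have "covers R a b" "prefix (a @ [i]) b"
      using down[of a b i] a b' i unfolding E'_iff by blast+
    moreover have "covers R a c" "prefix (a @ [j]) c"
      using down[of a c j] a c' j unfolding E'_iff by blast+
    ultimately show ?L'
      unfolding left_branch_iff by blast
  next
    assume ?L'
    then obtain a where l: "left_branch b c" and a: "covers R a b" "covers R a c" by blast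
    obtain d i j where d: "i < j" "prefix (d @ [i]) b" "prefix (d @ [j]) c"
      using l unfolding left_branch_iff by blast
    have bc: "a \<in> R" "b \<in> R" "c \<in> R" "prefix a b" "prefix a c" using a by (auto simp: covers_def)
    have "d \<in> R" using meet[OF bc(2,3) d(2,3)] d by simp
    \<comment> \<open>The parting point \<open>d\<close> of \<open>b\<close> and \<open>c\<close>
      lies at or below \<open>a\<close> and strictly above \<open>b\<close>; being kept, it equals
      \<open>a\<close>, because \<open>b\<close> covers \<open>a\<close>.\<close>
    have "prefix a (d @ [i]) \<or> prefix (d @ [i]) a"
      using bc d prefix_same_cases by blast
    moreover have "\<not> prefix (d @ [i]) c" using d by (auto simp: prefix_def)
    ultimately have "prefix a d" using bc by (auto simp: prefix_snoc)
    moreover have "prefix d b" "d \<noteq> b" using d by (auto simp: prefix_def)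
    ultimately have da: "d = a" using a \<open>d \<in> R\<close> by (auto simp: covers_def)
    have ch: "a @ [i] \<in> P" "a @ [j] \<in> P"
      using prefix_closedD[OF P] d da bc RP by blast+
    then have "a @ [i] \<in> path ?T a b \<inter> children ?T a" "a @ [j] \<in> path ?T a c \<inter> children ?T a"
      "(a @ [i], a @ [j]) \<in> left_of ?T"
      using d da a pth by (auto simp: children_addr_graph[OF P] left_of_addr_graph)
    moreover have "{a, b} \<in> E'" "{a, c} \<in> E'" unfolding E'_iff using a by auto
    ultimately show ?L
      using bc(1) by blast
  qed
  show "Red ?T = addr_tree R"
    using least_address[of r R, OF rR least]
    unfolding Red_def Let_def R E L r_def[symmetric] addr_tree_def
    by (simp add: E'_def)
qed

lemma covers_prefix_closed:
  assumes "prefix_closed P"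
  shows "covers P a b \<longleftrightarrow> b \<in> P \<and> (\<exists>i. b = a @ [i])"
proof
  assume c: "covers P a b"
  then have ab: "prefix a b" "a \<noteq> b" by (auto simp: covers_def)
  then obtain i where i: "prefix (a @ [i]) b"
    by (metis append_one_prefix prefix_length_less strict_prefixI)
  then have "a @ [i] \<in> P" using assms c by (auto simp: covers_def intro: prefix_closedD)
  then have "a @ [i] = b" using c i by (auto simp: covers_def)
  then show "b \<in> P \<and> (\<exists>i. b = a @ [i])" using c by (auto simp: covers_def)
next
  assume "b \<in> P \<and> (\<exists>i. b = a @ [i])"
  then show "covers P a b"
    using assms by (auto simp: covers_def prefix_snoc strict_prefix_def
        intro: prefix_closedD prefix_order.antisym)
qed

lemma left_branch_append: "left_branch (a @ b) (a @ c) \<longleftrightarrow> left_branch b c"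
  by (induction a) auto

text \<open>A prefix-closed set has no gaps, so its covering pairs are the parent-child pairs. Thus
  \<open>graph v\<close> takes the same form as a reduced tree, and \<open>iso_addr_tree\<close> can
  compare the two.\<close>

lemma addr_graph_eq_addr_tree:
  assumes "prefix_closed P" "P \<noteq> {}"
  shows "addr_graph P = addr_tree P"
proof -
  have "[] \<in> P" using assms by (auto intro: prefix_closedD)
  then have "(THE r. r \<in> P \<and> (\<forall>v\<in>P. prefix r v)) = []"
    by (intro least_address) auto
  moreover have "{{p, p @ [i]} | p i. p @ [i] \<in> P} = {{a, b} | a b. covers P a b}"
    unfolding covers_prefix_closed[OF assms(1)] by (intro Collect_cong) auto
  moreover have "((b, c) \<in> left_of (addr_graph P)) \<longleftrightarrow>
      left_branch b c \<and> (\<exists>a. covers P a b \<and> covers P a c)" for b c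
    unfolding covers_prefix_closed[OF assms(1)] left_of_addr_graph
    by (auto simp: left_branch_append)
  then have "left_of (addr_graph P) = {(b, c). left_branch b c \<and> (\<exists>a. covers P a b \<and> covers P a c)}"
    by auto
  ultimately show ?thesis by (simp add: addr_graph_def addr_tree_def)
qed

text \<open>\<open>addr_tree\<close> is built from \<open>prefix\<close> and
  \<open>left_branch\<close> alone, so a bijection preserving both transports everything. The least
  element \<open>r\<close> gives the definite description of the root its meaning on both
  sides.\<close>

lemma iso_addr_tree:
  assumes bij: "bij_betw f R R'"
    and pre: "\<And>a b. a \<in> R \<Longrightarrow> b \<in> R \<Longrightarrow> prefix (f a) (f b) \<longleftrightarrow> prefix a b"
    and left: "\<And>a b. a \<in> R \<Longrightarrow> b \<in> R \<Longrightarrow> left_branch (f a) (f b) \<longleftrightarrow> left_branch a b"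
    and r: "r \<in> R" "\<And>v. v \<in> R \<Longrightarrow> prefix r v"
  shows "addr_tree R \<cong> addr_tree R'"
proof -
  have R': "R' = f ` R" using bij by (simp add: bij_betw_def)
  have inj: "f a = f b \<longleftrightarrow> a = b" if "a \<in> R" "b \<in> R" for a b
    using bij that by (auto simp: bij_betw_def inj_on_def)
  have cov: "covers R' (f a) (f b) \<longleftrightarrow> covers R a b" if "a \<in> R" "b \<in> R" for a b
    using that unfolding covers_def R' by (auto simp: pre inj strict_prefix_def)
  have cov': "(\<exists>a. covers R' a (f b) \<and> covers R' a (f c)) \<longleftrightarrow> (\<exists>a. covers R a b \<and> covers R a c)"
    if "b \<in> R" "c \<in> R" for b c
  proof
    assume "\<exists>a. covers R' a (f b) \<and> covers R' a (f c)"
    then obtain a' where "covers R' a' (f b)" "covers R' a' (f c)" by blast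
    moreover from this obtain a where "a' = f a" "a \<in> R" by (auto simp: covers_def R')
    ultimately show "\<exists>a. covers R a b \<and> covers R a c" using cov that by blast
  next
    assume "\<exists>a. covers R a b \<and> covers R a c"
    then obtain a where "covers R a b" "covers R a c" by blast
    moreover from this have "a \<in> R" by (auto simp: covers_def)
    ultimately show "\<exists>a. covers R' a (f b) \<and> covers R' a (f c)" using cov that by blast
  qed
  have "(THE r. r \<in> R \<and> (\<forall>v\<in>R. prefix r v)) = r" using r by (rule least_address)
  moreover have "(THE r. r \<in> R' \<and> (\<forall>v\<in>R'. prefix r v)) = f r"
    using r pre by (intro least_address) (auto simp: R')
  ultimately have root: "f (root (addr_tree R)) = root (addr_tree R')"
    by (simp add: addr_tree_def)
  have left_of: "(b, c) \<in> left_of (addr_tree S) \<longleftrightarrow>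
      left_branch b c \<and> (\<exists>a. covers S a b \<and> covers S a c)" for b c S
    by (simp add: addr_tree_def)
  have verts: "verts (addr_tree S) = S" for S by (simp add: addr_tree_def)
  show ?thesis
    unfolding iso_def verts edges_addr_tree left_of
    using bij root cov cov' left by (intro exI[of _ f]) simp
qed

text \<open>The inverse of the vertex bijection sends the root back only if the root is a vertex,
  which the record type does not guarantee.\<close>

lemma iso_sym:
  assumes "S \<cong> T" "root S \<in> verts S"
  shows "T \<cong> S"
proof -
  obtain f where f: "bij_betw f (verts S) (verts T)" "f (root S) = root T"
    "\<And>a b. a \<in> verts S \<Longrightarrow> b \<in> verts S \<Longrightarrow>
       ({a, b} \<in> edges S \<longleftrightarrow> {f a, f b} \<in> edges T) \<and>
       ((a, b) \<in> left_of S \<longleftrightarrow> (f a, f b) \<in> left_of T)"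
    using assms(1) unfolding iso_def by blast
  define g where "g = inv_into (verts S) f"
  have g: "bij_betw g (verts T) (verts S)" unfolding g_def using f(1) by (rule bij_betw_inv_into)
  have fg: "f (g a) = a" "g a \<in> verts S" if "a \<in> verts T" for a
    using that f(1) by (auto simp: g_def bij_betw_def f_inv_into_f inv_into_into)
  have "g (root T) = root S"
    using f(1,2) assms(2) by (metis g_def bij_betw_inv_into_left)
  moreover have "({a, b} \<in> edges T \<longleftrightarrow> {g a, g b} \<in> edges S) \<and>
       ((a, b) \<in> left_of T \<longleftrightarrow> (g a, g b) \<in> left_of S)" if "a \<in> verts T" "b \<in> verts T" for a b
    using f(3)[of "g a" "g b"] fg that by simp
  ultimately show ?thesis using g unfolding iso_def by blast
qed

lemma iso_trans:
  assumes "S \<cong> T" "T \<cong> U"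
  shows "S \<cong> U"
proof -
  obtain f where f: "bij_betw f (verts S) (verts T)" "f (root S) = root T"
    "\<And>a b. a \<in> verts S \<Longrightarrow> b \<in> verts S \<Longrightarrow>
       ({a, b} \<in> edges S \<longleftrightarrow> {f a, f b} \<in> edges T) \<and>
       ((a, b) \<in> left_of S \<longleftrightarrow> (f a, f b) \<in> left_of T)"
    using assms(1) unfolding iso_def by blast
  obtain g where g: "bij_betw g (verts T) (verts U)" "g (root T) = root U"
    "\<And>a b. a \<in> verts T \<Longrightarrow> b \<in> verts T \<Longrightarrow>
       ({a, b} \<in> edges T \<longleftrightarrow> {g a, g b} \<in> edges U) \<and>
       ((a, b) \<in> left_of T \<longleftrightarrow> (g a, g b) \<in> left_of U)"
    using assms(2) unfolding iso_def by blast
  have "f a \<in> verts T" if "a \<in> verts S" for a using that f(1) by (auto simp: bij_betw_def)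
  then have "({a, b} \<in> edges S \<longleftrightarrow> {(g \<circ> f) a, (g \<circ> f) b} \<in> edges U) \<and>
       ((a, b) \<in> left_of S \<longleftrightarrow> ((g \<circ> f) a, (g \<circ> f) b) \<in> left_of U)"
    if "a \<in> verts S" "b \<in> verts S" for a b
    using that f(3)[of a b] g(3)[of "f a" "f b"] by simp
  moreover have "(g \<circ> f) (root S) = root U" using f(2) g(2) by simp
  ultimately show ?thesis
    using bij_betw_trans[OF f(1) g(1)] unfolding iso_def by blast
qed

section \<open>Rigidity: isomorphic planar trees have the same addresses\<close>

lemma prt_induct:
  assumes "\<And>T. (\<And>S. S \<in> set (subtrees T) \<Longrightarrow> Q S) \<Longrightarrow> Q T"
  shows "Q T"
  by (induction T rule: prt.induct) (rule assms; auto)+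

lemma subtrees_inject: "subtrees S = subtrees T \<Longrightarrow> S = T"
  by (cases S; cases T) auto

lemma address_simps [simp]:
  "address T []"
  "address T (i # p) \<longleftrightarrow> i < length (subtrees T) \<and> address (subtrees T ! i) p"
  by (auto intro: address.intros elim: address.cases)

lemma address_prefix_closed: "prefix_closed {p. address T p}"
  unfolding prefix_closed_def
proof (intro ballI allI impI; simp)
  fix b a assume "address T b" "prefix a b"
  then show "address T a"
    by (induction arbitrary: a) (auto simp: prefix_Cons)
qed

lemma address_inject: "{p. address S p} = {p. address T p} \<Longrightarrow> S = T"
proof (induction S arbitrary: T rule: prt_induct)
  case (1 S)
  have iff: "address S p \<longleftrightarrow> address T p" for p using 1(2) by blast
  have "i < length (subtrees S) \<longleftrightarrow> i < length (subtrees T)" for i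
    using iff[of "[i]"] by simp
  then have len: "length (subtrees S) = length (subtrees T)"
    by (metis linorder_neqE_nat order_less_irrefl)
  have "subtrees S ! i = subtrees T ! i" if i: "i < length (subtrees S)" for i
  proof (rule 1(1))
    show "subtrees S ! i \<in> set (subtrees S)" using i by simp
    have "address (subtrees S ! i) p \<longleftrightarrow> address (subtrees T ! i) p" for p
      using iff[of "i # p"] i len by simp
    then show "{p. address (subtrees S ! i) p} = {p. address (subtrees T ! i) p}" by simp
  qed
  then have "subtrees S = subtrees T" using len by (simp add: list_eq_iff_nth_eq)
  then show ?case by (rule subtrees_inject)
qed

lemma graph_eq_addr_graph: "graph T = addr_graph {p. address T p}"
  by (simp add: graph_def addr_graph_def)

text \<open>A strictly increasing map on an initial segment never falls below the identity. This is
  used for \<open>g\<close> and for its inverse \<open>h\<close>, the latter at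
  \<open>g i\<close>.\<close>

lemma increasing_bij_lessThan:
  fixes g :: "nat \<Rightarrow> nat"
  assumes bij: "bij_betw g {..<n} {..<m}"
    and mono: "\<And>i j. i < j \<Longrightarrow> j < n \<Longrightarrow> g i < g j" and "i < n"
  shows "g i = i"
proof -
  have ge: "i \<le> h i" if "\<And>i j. i < j \<Longrightarrow> j < k \<Longrightarrow> h i < h j" "i < k" for h :: "nat \<Rightarrow> nat" and k i
    using that(2)
  proof (induction i)
    case (Suc i)
    then show ?case using that(1)[of i "Suc i"] by simp
  qed simp
  define h where "h = inv_into {..<n} g"
  have hg: "h (g i) = i" if "i < n" for i
    using bij that by (auto simp: h_def bij_betw_def)
  have gh: "g (h j) = j" "h j < n" if "j < m" for j
    using bij that by (auto simp: h_def bij_betw_def f_inv_into_f)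
      (metis imageI inv_into_into lessThan_iff)
  have "h j < h j'" if "j < j'" "j' < m" for j j'
  proof (rule ccontr)
    assume "\<not> h j < h j'"
    then have "h j' < h j \<or> h j' = h j" by auto
    then show False using mono[of "h j'" "h j"] gh[of j] gh[of j'] that by auto
  qed
  moreover have "g i < m" using bij \<open>i < n\<close> by (auto simp: bij_betw_def)
  ultimately have "g i \<le> h (g i)" by (intro ge)
  moreover have "i \<le> g i" using mono \<open>i < n\<close> by (intro ge)
  ultimately show ?thesis using hg[OF \<open>i < n\<close>] by simp
qed

lemma address_children:
  assumes "address T p"
  obtains n where "\<And>i. address T (p @ [i]) \<longleftrightarrow> i < n"
proof -
  have "\<exists>n. \<forall>i. address T (p @ [i]) \<longleftrightarrow> i < n"
    using assms by induction auto
  then show ?thesis using that by blast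
qed

text \<open>Induction from the root: once \<open>a\<close> is fixed, its children go to neighbours
  of \<open>a\<close>, and these are children because the parent of \<open>a\<close> is already
  fixed and therefore taken. The left-to-right order then leaves only the identity.\<close>

lemma graph_iso_fixes_addresses:
  assumes bij: "bij_betw f {p. address S p} {p. address T p}" and root: "f [] = []"
    and edge: "\<And>a b. address S a \<Longrightarrow> address S b \<Longrightarrow>
       {a, b} \<in> edges (graph S) \<longleftrightarrow> {f a, f b} \<in> edges (graph T)"
    and left: "\<And>a b. address S a \<Longrightarrow> address S b \<Longrightarrow>
       (a, b) \<in> left_of (graph S) \<longleftrightarrow> (f a, f b) \<in> left_of (graph T)"
    and "address S p"
  shows "f p = p"
  using assms(5)
proof (induction p rule: length_induct)
  case (1 p)
  show ?case
  proof (cases p rule: rev_cases)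
    case Nil
    then show ?thesis using root by simp
  next
    case (snoc a k)
    have fT: "address T (f b)" if "address S b" for b
      using bij that by (auto simp: bij_betw_def)
    have inj: "b = c" if "f b = f c" "address S b" "address S c" for b c
      using bij that by (auto simp: bij_betw_def inj_on_def)
    have aS: "address S a" using 1 snoc prefix_closedD[OF address_prefix_closed, of p S a] by simp
    then have fa: "f a = a" using 1 snoc by simp
    have parent: "f c = c" if "a = c @ [j]" for c j
      using 1 snoc that aS prefix_closedD[OF address_prefix_closed, of a S c] by simp
    have aT: "address T a" using fT[OF aS] fa by simp
    obtain n where n: "\<And>i. address S (a @ [i]) \<longleftrightarrow> i < n" using address_children[OF aS] by blast
    obtain m where m: "\<And>i. address T (a @ [i]) \<longleftrightarrow> i < m" using address_children[OF aT] by blast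
    have child: "\<exists>j<m. f (a @ [i]) = a @ [j]" if "i < n" for i
    proof -
      have i: "address S (a @ [i])" using n that by simp
      have "{a, f (a @ [i])} \<in> edges (graph T)"
        using edge[OF aS i] i fa by (auto simp: graph_eq_addr_graph edges_addr_graph)
      then consider j where "f (a @ [i]) = a @ [j]" | j where "a = f (a @ [i]) @ [j]"
        by (auto simp: graph_eq_addr_graph edges_addr_graph)
      then show ?thesis
      proof cases
        case 1
        then show ?thesis using fT[OF i] m by auto
      next
        case 2
        let ?c = "f (a @ [i])"
        have "f ?c = ?c" using parent 2 by blast
        moreover have "address S ?c"
          using 2 aS prefix_closedD[OF address_prefix_closed, of a S ?c] by (metis mem_Collect_eq prefixI)
        ultimately have "a @ [i] = ?c" using inj i by metis
        then show ?thesis using 2 by (metis append.assoc append_self_conv not_Cons_self2 Nil_is_append_conv)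
      qed
    qed
    then obtain g where g: "\<And>i. i < n \<Longrightarrow> g i < m \<and> f (a @ [i]) = a @ [g i]" by metis
    have "inj_on g {..<n}"
      using g n inj by (metis (no_types, lifting) inj_onI lessThan_iff same_append_eq list.inject)
    moreover have "j \<in> g ` {..<n}" if "j < m" for j
    proof -
      have "address T (a @ [j])" using m that by simp
      then obtain x where x: "address S x" "f x = a @ [j]"
        using bij by (auto simp: bij_betw_def) (metis imageE mem_Collect_eq)
      have "{f a, f x} \<in> edges (graph T)"
        using x fa \<open>address T (a @ [j])\<close> by (auto simp: graph_eq_addr_graph edges_addr_graph)
      then have "{a, x} \<in> edges (graph S)" using edge[OF aS x(1)] by simp
      then consider i where "x = a @ [i]" | i where "a = x @ [i]"
        by (auto simp: graph_eq_addr_graph edges_addr_graph)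
      then show ?thesis
      proof cases
        case 1
        then have "i < n" using x n by simp
        then show ?thesis using g[of i] x 1 by auto
      next
        case 2
        then show ?thesis using parent[of x i] x by simp
      qed
    qed
    ultimately have "bij_betw g {..<n} {..<m}" using g by (auto simp: bij_betw_def)
    moreover have "g i < g j" if "i < j" "j < n" for i j
    proof -
      have ij: "address S (a @ [i])" "address S (a @ [j])" using n that by auto
      have "(a @ [i], a @ [j]) \<in> left_of (graph S)"
        using ij that by (auto simp: graph_eq_addr_graph left_of_addr_graph)
      then have "(a @ [g i], a @ [g j]) \<in> left_of (graph T)"
        using left[OF ij] g[of i] g[of j] that by simp
      then show ?thesis by (auto simp: graph_eq_addr_graph left_of_addr_graph)
    qed
    moreover have "k < n" using 1 snoc n by simp
    ultimately have "g k = k" by (rule increasing_bij_lessThan)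
    then show ?thesis using g[OF \<open>k < n\<close>] snoc by simp
  qed
qed

lemma graph_iso_imp_eq:
  assumes "graph S \<cong> graph T"
  shows "S = T"
proof -
  have sub: "{p. address S p} \<subseteq> {p. address T p}" if "graph S \<cong> graph T" for S T
  proof -
    obtain f where f: "bij_betw f {p. address S p} {p. address T p}" "f [] = []"
      "\<And>a b. address S a \<Longrightarrow> address S b \<Longrightarrow>
         ({a, b} \<in> edges (graph S) \<longleftrightarrow> {f a, f b} \<in> edges (graph T)) \<and>
         ((a, b) \<in> left_of (graph S) \<longleftrightarrow> (f a, f b) \<in> left_of (graph T))"
      using \<open>graph S \<cong> graph T\<close> unfolding iso_def by (auto simp: graph_def)
    have "f p = p" if "address S p" for p
      by (rule graph_iso_fixes_addresses[of f S T]) (use f that in auto)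
    then show ?thesis using f(1) by (force simp: bij_betw_def)
  qed
  have "graph T \<cong> graph S" using assms by (rule iso_sym) (simp add: graph_def)
  then show ?thesis using sub assms by (intro address_inject equalityI)
qed


section \<open>Recursive restriction\<close>

text \<open>Grafting extended to zero and one tree. That \<open>graft [v]\<close> is
  \<open>v\<close> itself reflects the suppression of vertices of arity 1.\<close>

fun graft :: "prt list \<Rightarrow> prt option" where
  "graft [] = None"
| "graft [v] = Some v"
| "graft (v1 # v2 # vs) = Some (Graft v1 v2 vs)"

fun opt_cons :: "'a option \<Rightarrow> 'a list \<Rightarrow> 'a list" where
  "opt_cons None vs = vs"
| "opt_cons (Some v) vs = v # vs"

primrec nodes :: "prt \<Rightarrow> nat" where
  "nodes Leaf = 1"
| "nodes (Graft T1 T2 Ts) = 1 + nodes T1 + nodes T2 + sum_list (map nodes Ts)"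

lemma nodes_pos: "nodes T > 0"
  by (cases T) auto

text \<open>T|I computed branch by branch. In \<open>restrs\<close>, an address \<open>i # p\<close>
  means the address \<open>p\<close> in tree number \<open>i\<close>; branches without a leaf in
  \<open>I\<close> leave no entry.\<close>

function restr :: "prt \<Rightarrow> nat list set \<Rightarrow> prt option"
  and restrs :: "prt list \<Rightarrow> nat list set \<Rightarrow> prt list" where
  "restr Leaf I = (if I = {} then None else Some Leaf)"
| "restr (Graft T1 T2 Ts) I = graft (restrs (T1 # T2 # Ts) I)"
| "restrs [] I = []"
| "restrs (T # Ts) I =
     opt_cons (restr T {p. 0 # p \<in> I}) (restrs Ts {i # p | i p. Suc i # p \<in> I})"
  by pat_completeness auto
termination
  \<comment> \<open>Doubling leaves room for the step from a grafting to its list of branches, 2(1 +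
    s) > 2s + 1; dropping a tree decreases the measure because \<open>nodes\<close> is
    positive.\<close>
  by (relation "measure (case_sum (\<lambda>p. 2 * nodes (fst p)) (\<lambda>p. 2 * sum_list (map nodes (fst p)) + 1))")
    (auto simp: nodes_pos)

lemma restr_empty: "I = {} \<Longrightarrow> restr T I = None" "I = {} \<Longrightarrow> restrs Ts I = []"
  by (induction T I and Ts I rule: restr_restrs.induct) auto

lemma leaves_graph: "leaves (graph T) = {p. address T p \<and> (\<forall>i. \<not> address T (p @ [i]))}"
proof -
  have "arity (graph T) p = 0 \<longleftrightarrow> (\<forall>i. \<not> address T (p @ [i]))" if p: "address T p" for p
  proof -
    obtain n where n: "\<And>i. address T (p @ [i]) \<longleftrightarrow> i < n" using address_children[OF p] by blast
    have "arity (graph T) p = card {i. address T (p @ [i])}"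
      unfolding graph_eq_addr_graph arity_addr_graph[OF address_prefix_closed] by simp
    then have "arity (graph T) p = n" by (simp add: n)
    moreover have "n = 0 \<longleftrightarrow> (\<forall>i. \<not> i < n)" by (metis gr0I less_nat_zero_code)
    ultimately show ?thesis by (simp add: n)
  qed
  then show ?thesis by (auto simp: leaves_def graph_def)
qed

definition forest_leaves :: "prt list \<Rightarrow> nat list set" where
  "forest_leaves Ts = {i # p | i p. i < length Ts \<and> p \<in> leaves (graph (Ts ! i))}"

lemma leaves_Leaf: "leaves (graph Leaf) = {[]}"
proof -
  have "address Leaf p \<longleftrightarrow> p = []" for p by (cases p) auto
  then show ?thesis by (auto simp: leaves_graph)
qed

lemma leaves_Graft: "leaves (graph (Graft T1 T2 Ts)) = forest_leaves (T1 # T2 # Ts)"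
proof -
  have "p \<in> leaves (graph (Graft T1 T2 Ts)) \<longleftrightarrow> p \<in> forest_leaves (T1 # T2 # Ts)" for p
  proof (cases p)
    case Nil
    have "address (Graft T1 T2 Ts) [0]" by simp
    then show ?thesis using Nil by (auto simp: leaves_graph forest_leaves_def)
  next
    case (Cons i r)
    then show ?thesis by (auto simp: leaves_graph forest_leaves_def)
  qed
  then show ?thesis by blast
qed

text \<open>Renumbers the branches when a tree is put in front of a forest. The clause for
  \<open>[]\<close> is a default: forests have no address \<open>[]\<close>.\<close>

fun shift :: "nat list \<Rightarrow> nat list" where
  "shift [] = []"
| "shift (i # p) = Suc i # p"

lemma Cons_in_shift_image: "0 # r \<notin> shift ` A" "Suc j # r \<in> shift ` A \<longleftrightarrow> j # r \<in> A"
proof -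
  have *: "0 # r \<noteq> shift p" "Suc j # r = shift p \<longleftrightarrow> p = j # r" for p by (cases p; auto)+
  then show "0 # r \<notin> shift ` A" "Suc j # r \<in> shift ` A \<longleftrightarrow> j # r \<in> A" by (simp_all add: image_iff *)
qed

lemma Nil_in_shift_image: "[] \<in> shift ` A \<longleftrightarrow> [] \<in> A"
proof -
  have "[] = shift p \<longleftrightarrow> p = []" for p by (cases p) auto
  then show ?thesis by (simp add: image_iff)
qed

lemma forest_leaves_Nil [simp]: "forest_leaves [] = {}"
  by (simp add: forest_leaves_def)

lemma Cons_in_forest_leaves:
  "i # p \<in> forest_leaves Ts \<longleftrightarrow> i < length Ts \<and> p \<in> leaves (graph (Ts ! i))"
  by (auto simp: forest_leaves_def)

lemma forest_leaves_Cons: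
  "forest_leaves (T # Ts) = (#) 0 ` leaves (graph T) \<union> shift ` forest_leaves Ts"
proof -
  have "p \<in> forest_leaves (T # Ts) \<longleftrightarrow> p \<in> (#) 0 ` leaves (graph T) \<union> shift ` forest_leaves Ts" for p
  proof (cases p)
    case Nil
    then show ?thesis by (auto simp: Nil_in_shift_image forest_leaves_def)
  next
    case (Cons i r)
    then show ?thesis by (cases i) (auto simp: Cons_in_forest_leaves Cons_in_shift_image)
  qed
  then show ?thesis by blast
qed

section \<open>Comparing the recursive restriction with the reduced spanned tree\<close>

definition forest_addresses :: "prt list \<Rightarrow> nat list set" where
  "forest_addresses Ts = {i # p | i p. i < length Ts \<and> address (Ts ! i) p}"

lemma Cons_in_forest_addresses:
  "i # p \<in> forest_addresses Ts \<longleftrightarrow> i < length Ts \<and> address (Ts ! i) p"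
  by (auto simp: forest_addresses_def)

lemma Nil_notin_forest_addresses: "[] \<notin> forest_addresses Ts"
  by (auto simp: forest_addresses_def)

lemma addresses_eq: "{p. address T p} = insert [] (forest_addresses (subtrees T))"
proof -
  have "address T p \<longleftrightarrow> p \<in> insert [] (forest_addresses (subtrees T))" for p
    by (cases p) (auto simp: forest_addresses_def)
  then show ?thesis by blast
qed

text \<open>The vertex set of $T_I$. Vertices keep their addresses in T, so the child indices may
  have gaps, and a spine need not be the address set of any \<open>prt\<close>.\<close>

definition spine :: "nat list set \<Rightarrow> nat list set" where
  "spine I = {p. \<exists>a\<in>I. prefix p a}"

lemma spineI: "a \<in> I \<Longrightarrow> prefix p a \<Longrightarrow> p \<in> spine I"
  by (auto simp: spine_def)

lemma prefix_closed_spine: "prefix_closed (spine I)"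
  by (auto simp: prefix_closed_def spine_def intro: prefix_order.order_trans)

lemma Cons_in_spine: "i # p \<in> spine I \<longleftrightarrow> p \<in> spine {r. i # r \<in> I}"
proof
  assume "i # p \<in> spine I"
  then obtain a where "a \<in> I" "prefix (i # p) a" by (auto simp: spine_def)
  moreover from this obtain r where "a = i # r" by (cases a) auto
  ultimately show "p \<in> spine {r. i # r \<in> I}" by (auto simp: spine_def)
next
  assume "p \<in> spine {r. i # r \<in> I}"
  then obtain r where "i # r \<in> I" "prefix (i # p) (i # r)" by (auto simp: spine_def)
  then show "i # p \<in> spine I" by (rule spineI)
qed

lemma Cons_in_branching_spine:
  "i # p \<in> branching (spine I) \<longleftrightarrow> p \<in> branching (spine {r. i # r \<in> I})"
  by (simp add: branching_def Cons_in_spine)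

text \<open>Tailored to \<open>iso_addr_tree\<close>; injectivity is implied, since
  \<open>f a = f b\<close> makes \<open>a\<close> and \<open>b\<close> prefixes of each
  other.\<close>

definition address_embedding ::
  "(nat list \<Rightarrow> nat list) \<Rightarrow> nat list set \<Rightarrow> nat list set \<Rightarrow> bool" where
  "address_embedding f A B \<longleftrightarrow> f ` A = B \<and> (\<forall>a\<in>A. \<forall>b\<in>A.
     (prefix (f a) (f b) \<longleftrightarrow> prefix a b) \<and> (left_branch (f a) (f b) \<longleftrightarrow> left_branch a b))"

lemma address_embedding_bij:
  assumes "address_embedding f A B"
  shows "bij_betw f A B"
  unfolding bij_betw_def
proof
  show "inj_on f A"
  proof (rule inj_onI)
    fix a b assume "a \<in> A" "b \<in> A" "f a = f b"
    then have "prefix a b" "prefix b a"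
      using assms prefix_order.order_refl unfolding address_embedding_def by metis+
    then show "a = b" by (rule prefix_order.antisym)
  qed
qed (use assms in \<open>simp add: address_embedding_def\<close>)

lemma address_embedding_insert_Nil:
  assumes f: "address_embedding f A B" and A: "[] \<notin> A" and B: "[] \<notin> B"
  shows "address_embedding (f([] := [])) (insert [] A) (insert [] B)"
proof -
  have "A \<inter> {x. x \<noteq> []} = A" using A by auto
  moreover have "f a \<noteq> []" "a \<noteq> []" if "a \<in> A" for a
  proof -
    have "f a \<in> B" using f that by (auto simp: address_embedding_def)
    then show "f a \<noteq> []" "a \<noteq> []" using A B that by metis+
  qed
  ultimately show ?thesis using f by (simp add: address_embedding_def)
qed

fun glue :: "(nat list \<Rightarrow> nat list) \<Rightarrow> (nat list \<Rightarrow> nat list) \<Rightarrow> nat list \<Rightarrow> nat list" where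
  "glue f g [] = []"
| "glue f g (0 # p) = 0 # f p"
| "glue f g (Suc i # p) = shift (g (i # p))"

lemma prefix_shift: "a \<noteq> [] \<Longrightarrow> prefix (shift a) (shift b) \<longleftrightarrow> prefix a b"
  by (cases a; cases b) auto

lemma left_branch_shift: "left_branch (shift a) (shift b) \<longleftrightarrow> left_branch a b"
  by (cases a; cases b) auto

lemma prefix_0_shift: "\<not> prefix (0 # p) (shift a)" "a \<noteq> [] \<Longrightarrow> \<not> prefix (shift a) (0 # p)"
  by (cases a; simp)+

lemma left_branch_0_shift: "a \<noteq> [] \<Longrightarrow> left_branch (0 # p) (shift a)" "\<not> left_branch (shift a) (0 # p)"
  by (cases a; simp)+

text \<open>The only vertex whose survival is not decided inside a branch is the root: it is kept
  unless exactly one branch meets \<open>I\<close>. So the forest version leaves \<open>[]\<close>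
  out and instead counts the branches met, through the addresses \<open>[i]\<close> in the
  spine.\<close>

lemma restr_embedding:
  "I \<noteq> {} \<Longrightarrow> I \<subseteq> leaves (graph T) \<Longrightarrow>
     \<exists>v f. restr T I = Some v \<and> address_embedding f {p. address v p} (branching (spine I))"
  "I \<subseteq> forest_leaves Ts \<Longrightarrow>
     (\<exists>f. address_embedding f (forest_addresses (restrs Ts I)) (branching (spine I) - {[]})) \<and>
     card {i. [i] \<in> spine I} = length (restrs Ts I)"
proof (induction T I and Ts I rule: restr_restrs.induct)
  case (1 I)
  then have I: "I = {[]}" by (auto simp: leaves_Leaf)
  have "spine I = {[]}" by (auto simp: I spine_def)
  then have "branching (spine I) = {[]}" by (auto simp: branching_def)
  moreover have "{p. address Leaf p} = {[]}" by (auto simp: addresses_eq forest_addresses_def)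
  ultimately show ?case using I by (intro exI[of _ Leaf] exI[of _ id]) (auto simp: address_embedding_def)
next
  case (2 T1 T2 Ts I)
  let ?vs = "restrs (T1 # T2 # Ts) I"
  have I: "I \<subseteq> forest_leaves (T1 # T2 # Ts)" using "2.prems" by (simp add: leaves_Graft)
  then obtain f where f: "address_embedding f (forest_addresses ?vs) (branching (spine I) - {[]})"
    and card: "card {i. [i] \<in> spine I} = length ?vs"
    using "2.IH" by blast
  obtain x where "x \<in> I" using "2.prems"(1) by blast
  moreover from this obtain i p where "x = i # p" using I by (auto simp: forest_leaves_def)
  ultimately have "i # p \<in> I" by simp
  then have "[] \<in> spine I" "[i] \<in> spine I" by (auto intro: spineI)
  have "{i. [i] \<in> spine I} \<subseteq> {..<length (T1 # T2 # Ts)}"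
  proof
    fix i assume "i \<in> {i. [i] \<in> spine I}"
    then obtain a where "a \<in> I" "prefix [i] a" by (auto simp: spine_def)
    then show "i \<in> {..<length (T1 # T2 # Ts)}"
      using I by (cases a) (auto simp: forest_leaves_def)
  qed
  \<comment> \<open>Finiteness matters: \<open>card\<close> of an infinite set would be 0 as
    well.\<close>
  then have "finite {i. [i] \<in> spine I}" by (rule finite_subset) simp
  then have "card {i. [i] \<in> spine I} \<noteq> 0" using \<open>[i] \<in> spine I\<close> by auto
  then have "?vs \<noteq> []" using card by auto
  have Nil: "[] \<in> branching (spine I) \<longleftrightarrow> length ?vs \<noteq> 1"
    using \<open>[] \<in> spine I\<close> card by (simp add: branching_def)
  show ?case
  \<comment> \<open>With one entry left the root is suppressed, and the tree at index 0 of the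
    forest becomes the whole tree. Otherwise the root survives, and \<open>[]\<close> is added on
    both sides.\<close>
  proof (cases "length ?vs = 1")
    case True
    then obtain v where v: "?vs = [v]" by (auto simp: length_Suc_conv)
    have "branching (spine I) - {[]} = branching (spine I)" using Nil True by simp
    moreover have "forest_addresses [v] = (#) 0 ` {p. address v p}"
      by (auto simp: forest_addresses_def)
    ultimately have "address_embedding (\<lambda>p. f (0 # p)) {p. address v p} (branching (spine I))"
      using f v by (auto simp: address_embedding_def)
    then show ?thesis using v by auto
  next
    case False
    then obtain v1 v2 vs where v: "?vs = v1 # v2 # vs"
      using \<open>?vs \<noteq> []\<close> by (metis One_nat_def length_Cons list.exhaust list.size(3))
    have "address_embedding (f([] := [])) (insert [] (forest_addresses ?vs)) (insert [] (branching (spine I) - {[]}))"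
      using f by (rule address_embedding_insert_Nil) (simp_all add: Nil_notin_forest_addresses)
    moreover have "insert [] (branching (spine I) - {[]}) = branching (spine I)"
      using Nil False by auto
    moreover have "insert [] (forest_addresses ?vs) = {p. address (Graft v1 v2 vs) p}"
      unfolding addresses_eq v by simp
    ultimately show ?thesis using v by auto
  qed
next
  case (3 I)
  then show ?case by (auto simp: spine_def branching_def address_embedding_def forest_addresses_def)
next
  case (4 T Ts I)
  define I0 where "I0 = {p. 0 # p \<in> I}"
  define I' where "I' = {i # p | i p. Suc i # p \<in> I}"
  have I0: "I0 \<subseteq> leaves (graph T)" using 4(3) by (auto simp: I0_def Cons_in_forest_leaves)
  have I': "I' \<subseteq> forest_leaves Ts" using 4(3) by (auto simp: I'_def Cons_in_forest_leaves)
  obtain g where g: "address_embedding g (forest_addresses (restrs Ts I')) (branching (spine I') - {[]})"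
    and card: "card {i. [i] \<in> spine I'} = length (restrs Ts I')"
    using 4(2) I' unfolding I'_def by blast
  have gimg: "g ` forest_addresses (restrs Ts I') = branching (spine I') - {[]}"
    using g by (simp add: address_embedding_def)
  have sp0: "0 # p \<in> spine I \<longleftrightarrow> p \<in> spine I0" for p by (simp add: Cons_in_spine I0_def)
  have spS: "Suc i # p \<in> spine I \<longleftrightarrow> i # p \<in> spine I'" for i p by (simp add: Cons_in_spine I'_def)
  have br0: "0 # p \<in> branching (spine I) \<longleftrightarrow> p \<in> branching (spine I0)" for p
    by (simp add: Cons_in_branching_spine I0_def)
  have brS: "Suc i # p \<in> branching (spine I) \<longleftrightarrow> i # p \<in> branching (spine I')" for i p
    by (simp add: Cons_in_branching_spine I'_def)
  have br: "branching (spine I) - {[]} =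
      (#) 0 ` branching (spine I0) \<union> shift ` (branching (spine I') - {[]})"
  proof -
    have "x \<in> branching (spine I) - {[]} \<longleftrightarrow>
      x \<in> (#) 0 ` branching (spine I0) \<union> shift ` (branching (spine I') - {[]})" for x
    proof (cases x)
      case Nil
      then show ?thesis by (auto simp: Nil_in_shift_image)
    next
      case (Cons i r)
      then show ?thesis by (cases i) (auto simp: br0 brS Cons_in_shift_image)
    qed
    then show ?thesis by blast
  qed
  have fin: "finite {i. [i] \<in> spine I'}"
  proof (rule finite_subset)
    show "{i. [i] \<in> spine I'} \<subseteq> {..<length Ts}"
    proof
      fix i assume "i \<in> {i. [i] \<in> spine I'}"
      then obtain a where "a \<in> I'" "prefix [i] a" by (auto simp: spine_def)
      then show "i \<in> {..<length Ts}"
        using I' by (cases a) (auto simp: forest_leaves_def)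
    qed
  qed simp
  have roots: "{i. [i] \<in> spine I} = (if I0 = {} then {} else {0}) \<union> Suc ` {i. [i] \<in> spine I'}"
  proof -
    have "i \<in> {i. [i] \<in> spine I} \<longleftrightarrow> i \<in> (if I0 = {} then {} else {0}) \<union> Suc ` {i. [i] \<in> spine I'}" for i
    proof (cases i)
      case 0
      then show ?thesis using sp0[of "[]"] by (auto simp: spine_def)
    next
      case (Suc j)
      then show ?thesis using spS[of j "[]"] by auto
    qed
    then show ?thesis by blast
  qed
  have ne: "a \<noteq> []" if "a \<in> forest_addresses vs" for a vs
    using that Nil_notin_forest_addresses by metis
  have gne: "g a \<noteq> []" if "a \<in> forest_addresses (restrs Ts I')" for a
    using gimg that by auto
  have restrs: "restrs (T # Ts) I = opt_cons (restr T I0) (restrs Ts I')"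
    by (simp add: I0_def I'_def)
  show ?case
  proof (cases "I0 = {}")
    case True
    then have "branching (spine I0) = {}" by (auto simp: branching_def spine_def)
    then have "address_embedding (shift \<circ> g) (forest_addresses (restrs Ts I')) (branching (spine I) - {[]})"
      using g gne br unfolding address_embedding_def
      by (simp add: prefix_shift left_branch_shift flip: image_image)
    moreover have "restrs (T # Ts) I = restrs Ts I'" using restrs True by (simp add: restr_empty)
    ultimately show ?thesis using roots True card by (auto simp: card_image)
  next
    case False
    obtain v f where v: "restr T I0 = Some v"
      and f: "address_embedding f {p. address v p} (branching (spine I0))"
      using 4(1) False I0 unfolding I0_def by blast
    let ?vs = "restrs Ts I'"
    have vs: "restrs (T # Ts) I = v # ?vs" using restrs v by simp
    have fa: "forest_addresses (v # ?vs) = (#) 0 ` {p. address v p} \<union> shift ` forest_addresses ?vs"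
    proof -
      have "x \<in> forest_addresses (v # ?vs) \<longleftrightarrow>
        x \<in> (#) 0 ` {p. address v p} \<union> shift ` forest_addresses ?vs" for x
      proof (cases x)
        case Nil
        then show ?thesis by (auto simp: Nil_in_shift_image Nil_notin_forest_addresses)
      next
        case (Cons i r)
        then show ?thesis by (cases i) (auto simp: Cons_in_forest_addresses Cons_in_shift_image)
      qed
      then show ?thesis by blast
    qed
    have gl: "glue f g (shift a) = shift (g a)" if "a \<in> forest_addresses ?vs" for a
      using ne[OF that] by (cases a) auto
    have "glue f g ` forest_addresses (v # ?vs) = branching (spine I) - {[]}"
    proof -
      have "f ` {p. address v p} = branching (spine I0)" using f by (simp add: address_embedding_def)
      then show ?thesis
        unfolding fa br image_Un image_image gimg[symmetric]
        by (auto simp: gl image_image)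
    qed
    moreover have "(prefix (glue f g a) (glue f g b) \<longleftrightarrow> prefix a b) \<and>
        (left_branch (glue f g a) (glue f g b) \<longleftrightarrow> left_branch a b)"
      if ab: "a \<in> forest_addresses (v # ?vs)" "b \<in> forest_addresses (v # ?vs)" for a b
    proof -
      have f': "(prefix (f a) (f b) \<longleftrightarrow> prefix a b) \<and> (left_branch (f a) (f b) \<longleftrightarrow> left_branch a b)"
        if "address v a" "address v b" for a b using f that by (simp add: address_embedding_def)
      have g': "(prefix (g a) (g b) \<longleftrightarrow> prefix a b) \<and> (left_branch (g a) (g b) \<longleftrightarrow> left_branch a b)"
        if "a \<in> forest_addresses ?vs" "b \<in> forest_addresses ?vs" for a b
        using g that by (simp add: address_embedding_def)
      \<comment> \<open>Inside one part the given embeddings apply. Across the two parts no address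
        is a prefix of the other, and the first tree is always on the left.\<close>
      consider p r where "a = 0 # p" "b = 0 # r" "address v p" "address v r"
        | p r where "a = 0 # p" "b = shift r" "address v p" "r \<in> forest_addresses ?vs"
        | p r where "a = shift p" "b = 0 # r" "p \<in> forest_addresses ?vs" "address v r"
        | p r where "a = shift p" "b = shift r" "p \<in> forest_addresses ?vs" "r \<in> forest_addresses ?vs"
        using ab unfolding fa by blast
      then show ?thesis
      proof cases
        case 1
        then show ?thesis using f' by simp
      next
        case 2
        then show ?thesis using gne ne by (simp add: gl prefix_0_shift left_branch_0_shift)
      next
        case 3
        then show ?thesis using gne ne by (simp add: gl prefix_0_shift left_branch_0_shift)
      next
        case 4
        then show ?thesis using gne ne g' by (simp add: gl prefix_shift left_branch_shift)
      qed
    qed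
    ultimately have "address_embedding (glue f g) (forest_addresses (v # ?vs)) (branching (spine I) - {[]})"
      by (simp add: address_embedding_def)
    moreover have "card {i. [i] \<in> spine I} = Suc (length ?vs)"
      using roots False fin by (simp add: card_image card)
    ultimately show ?thesis unfolding vs by auto
  qed
qed

lemma span_tree_graph:
  assumes "I \<subseteq> {p. address T p}"
  shows "span_tree (graph T) I = addr_graph (spine I)"
proof -
  have path: "path (graph T) a (root (graph T)) = {p. prefix p a}" if "a \<in> I" for a
    using path_to_prefix[OF address_prefix_closed, of a T "[]"] assms that
    by (auto simp: graph_eq_addr_graph)
  then have S: "(\<Union>a\<in>I. path (graph T) a (root (graph T))) = spine I"
    by (auto simp: spine_def)
  have sub: "address T p" if "p \<in> spine I" for p
    using that assms prefix_closedD[OF address_prefix_closed, of _ T p] by (auto simp: spine_def)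
  have "e \<in> edges (graph T) \<and> (\<exists>a\<in>I. e \<subseteq> path (graph T) a (root (graph T))) \<longleftrightarrow>
      (\<exists>p i. e = {p, p @ [i]} \<and> p @ [i] \<in> spine I)" (is "?L \<longleftrightarrow> ?R") for e
  proof
    assume ?L
    then obtain p i a where "e = {p, p @ [i]}" "a \<in> I" "e \<subseteq> path (graph T) a (root (graph T))"
      by (auto simp: graph_def)
    then show ?R using path by (auto simp: spine_def)
  next
    assume ?R
    then obtain p i a where e: "e = {p, p @ [i]}" "a \<in> I" "prefix (p @ [i]) a" "p @ [i] \<in> spine I"
      by (auto simp: spine_def)
    then have "prefix p a" by (auto intro: append_prefixD)
    then have "e \<subseteq> path (graph T) a (root (graph T))" using e path by simp
    moreover have "e \<in> edges (graph T)" using sub[OF e(4)] e(1) by (auto simp: graph_def)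
    ultimately show ?L using e(2) by blast
  qed
  then have E: "{e \<in> edges (graph T). \<exists>a\<in>I. e \<subseteq> path (graph T) a (root (graph T))} =
      {{p, p @ [i]} | p i. p @ [i] \<in> spine I}"
    by (intro Collect_cong)
  have L: "left_of (graph T) \<inter> spine I \<times> spine I =
      {(p @ [i], p @ [j]) | p i j. i < j \<and> p @ [i] \<in> spine I \<and> p @ [j] \<in> spine I}"
    using sub by (auto simp: graph_def)
  show ?thesis
    unfolding span_tree_def Let_def S E L addr_graph_def by (simp add: graph_def)
qed

lemma Red_span_tree:
  assumes "I \<noteq> {}" "I \<subseteq> leaves (graph T)"
  obtains v where "restr T I = Some v" "graph v \<cong> Red (span_tree (graph T) I)"
proof -
  obtain v f where v: "restr T I = Some v"
    and f: "address_embedding f {p. address v p} (branching (spine I))"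
    using restr_embedding(1)[OF assms] by blast
  have "branching (spine I) \<noteq> {}"
    using f by (auto simp: address_embedding_def addresses_eq)
  then have "Red (addr_graph (spine I)) = addr_tree (branching (spine I))"
    by (rule Red_addr_graph[OF prefix_closed_spine])
  moreover have "span_tree (graph T) I = addr_graph (spine I)"
    using assms(2) by (intro span_tree_graph) (auto simp: leaves_graph)
  moreover have "graph v = addr_tree {p. address v p}"
    unfolding graph_eq_addr_graph
    by (rule addr_graph_eq_addr_tree[OF address_prefix_closed]) (simp add: addresses_eq)
  moreover have "addr_tree {p. address v p} \<cong> addr_tree (branching (spine I))"
    by (rule iso_addr_tree[OF address_embedding_bij[OF f], where r = "[]"])
      (use f in \<open>auto simp: address_embedding_def\<close>)
  ultimately show ?thesis using v that by simp
qed

text \<open>By rigidity the reduction is isomorphic to the graph of exactly one \<open>prt\<close>,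
  namely the value of \<open>restr\<close>. From here on paths and isomorphisms are out of the
  argument.\<close>

lemma restricts_to_iff:
  assumes "I \<subseteq> leaves (graph T)"
  shows "restricts_to (Some T) I V \<longleftrightarrow> restr T I = V"
proof (cases "I = {}")
  case True
  then show ?thesis by (auto simp: restricts_to_def restr_empty)
next
  case False
  then obtain v where v: "restr T I = Some v" and iso: "graph v \<cong> Red (span_tree (graph T) I)"
    using Red_span_tree assms by metis
  have "Red (span_tree (graph T) I) \<cong> graph w \<longleftrightarrow> v = w" for w
  proof
    show "v = w" if "Red (span_tree (graph T) I) \<cong> graph w"
      using iso_trans[OF iso that] by (rule graph_iso_imp_eq)
    show "Red (span_tree (graph T) I) \<cong> graph w" if "v = w"
      using iso_sym[OF iso] that by (simp add: graph_def)
  qed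
  then show ?thesis using False v by (auto simp: restricts_to_def)
qed


section \<open>Splittings of leaf sets\<close>

lemma card_fibres:
  assumes "finite A" "finite S"
  shows "card {x \<in> A. g x \<in> S} = (\<Sum>s\<in>S. card {x \<in> A. g x = s})"
proof -
  have "{x \<in> A. g x \<in> S} = (\<Union>s\<in>S. {x \<in> A. g x = s})" by auto
  also have "card \<dots> = (\<Sum>s\<in>S. card {x \<in> A. g x = s})"
    using assms by (intro card_UN_disjoint) auto
  finally show ?thesis .
qed

lemma finite_leaves: "finite (leaves (graph T))"
proof (induction T rule: prt_induct)
  case (1 T)
  have "finite (forest_leaves (subtrees T))"
  proof -
    have "forest_leaves (subtrees T) =
        (\<Union>i<length (subtrees T). (#) i ` leaves (graph (subtrees T ! i)))"
      by (auto simp: forest_leaves_def)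
    then show ?thesis using 1 by simp
  qed
  then show ?case by (cases T) (auto simp: leaves_Leaf leaves_Graft)
qed

lemma finite_forest_leaves: "finite (forest_leaves Ts)"
  by (induction Ts) (auto simp: forest_leaves_Cons finite_leaves)

lemma deg_Leaf: "deg Leaf = 1"
  by (simp add: deg_def leaves_Leaf)

lemma Nil_notin_forest_leaves: "[] \<notin> forest_leaves Ts"
  by (auto simp: forest_leaves_def)

lemma inj_on_shift: "[] \<notin> A \<Longrightarrow> inj_on shift A"
proof (rule inj_onI)
  fix a b assume "[] \<notin> A" "a \<in> A" "b \<in> A" "shift a = shift b"
  then show "a = b" by (cases a; cases b) auto
qed

lemma card_join:
  assumes "finite A" "finite B" "[] \<notin> B"
  shows "card ((#) 0 ` A \<union> shift ` B) = card A + card B"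
proof -
  have "(#) 0 ` A \<inter> shift ` B = {}" using Cons_in_shift_image(1) by blast
  then show ?thesis
    using assms by (simp add: card_Un_disjoint card_image inj_on_shift)
qed

lemma card_forest_leaves: "card (forest_leaves Ts) = sum_list (map deg Ts)"
  by (induction Ts)
    (simp_all add: forest_leaves_Cons card_join finite_leaves finite_forest_leaves
      Nil_notin_forest_leaves deg_def)

lemma deg_Graft: "deg (Graft T1 T2 Ts) = sum_list (map deg (T1 # T2 # Ts))"
  unfolding deg_def[of "Graft T1 T2 Ts"] leaves_Graft card_forest_leaves ..

lemma deg_pos: "deg T > 0"
proof (induction T rule: prt_induct)
  case (1 T)
  then show ?case by (cases T) (auto simp: deg_Leaf deg_Graft)
qed

lemma length_le_sum_deg: "length Ts \<le> sum_list (map deg Ts)"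
proof (induction Ts)
  case (Cons T Ts)
  then show ?case using deg_pos[of T] by simp
qed simp

lemma deg_subtree_less:
  assumes "T \<in> set Ts" "length Ts \<ge> 2"
  shows "deg T < sum_list (map deg Ts)"
proof -
  obtain xs ys where Ts: "Ts = xs @ T # ys" using assms(1) by (meson split_list)
  then have "length xs + length ys \<ge> 1" using assms(2) by simp
  moreover have "length xs + length ys \<le> sum_list (map deg xs) + sum_list (map deg ys)"
    by (intro add_mono length_le_sum_deg)
  ultimately have "0 < sum_list (map deg xs) + sum_list (map deg ys)" by linarith
  then show ?thesis using Ts by simp
qed

definition opt_deg :: "prt option \<Rightarrow> nat" where
  "opt_deg V = (case V of None \<Rightarrow> 0 | Some v \<Rightarrow> deg v)"

lemma opt_deg_simps [simp]: "opt_deg None = 0" "opt_deg (Some v) = deg v"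
  by (simp_all add: opt_deg_def)

lemma opt_deg_graft: "opt_deg (graft vs) = sum_list (map deg vs)"
  by (cases vs rule: graft.cases) (simp_all add: deg_Graft)

lemma sum_deg_opt_cons: "sum_list (map deg (opt_cons V vs)) = opt_deg V + sum_list (map deg vs)"
  by (cases V) auto

lemma opt_deg_eq_0: "opt_deg V = 0 \<longleftrightarrow> V = None"
proof (cases V)
  case (Some v)
  then show ?thesis using deg_pos[of v] by simp
qed simp

lemma decompose_Cons:
  assumes "[] \<notin> I"
  shows "I = (#) 0 ` {p. 0 # p \<in> I} \<union> shift ` {i # p | i p. Suc i # p \<in> I}"
proof -
  have "x \<in> I \<longleftrightarrow> x \<in> (#) 0 ` {p. 0 # p \<in> I} \<union> shift ` {i # p | i p. Suc i # p \<in> I}" for x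
  proof (cases x)
    case Nil
    then show ?thesis using assms by (auto simp: Nil_in_shift_image)
  next
    case (Cons i r)
    then show ?thesis by (cases i) (auto simp: Cons_in_shift_image)
  qed
  then show ?thesis by blast
qed

lemma opt_deg_restr:
  "I \<subseteq> leaves (graph T) \<Longrightarrow> opt_deg (restr T I) = card I"
  "I \<subseteq> forest_leaves Ts \<Longrightarrow> sum_list (map deg (restrs Ts I)) = card I"
proof (induction T I and Ts I rule: restr_restrs.induct)
  case (1 I)
  then have "I = {} \<or> I = {[]}" by (auto simp: leaves_Leaf)
  then show ?case by (auto simp: deg_Leaf)
next
  case (2 T1 T2 Ts I)
  then show ?case unfolding restr.simps opt_deg_graft leaves_Graft by blast
next
  case (3 I)
  then show ?case by simp
next
  case (4 T Ts I)
  let ?I0 = "{p. 0 # p \<in> I}" and ?I' = "{i # p | i p. Suc i # p \<in> I}"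
  have I0: "?I0 \<subseteq> leaves (graph T)" using 4(3) by (auto simp: Cons_in_forest_leaves)
  have I': "?I' \<subseteq> forest_leaves Ts" using 4(3) by (auto simp: Cons_in_forest_leaves)
  have "[] \<notin> I" using 4(3) Nil_notin_forest_leaves by blast
  then have "card I = card ((#) 0 ` ?I0 \<union> shift ` ?I')"
    by (rule arg_cong[OF decompose_Cons])
  also have "\<dots> = card ?I0 + card ?I'"
    by (rule card_join)
      (use finite_subset[OF I0 finite_leaves] finite_subset[OF I' finite_forest_leaves] in auto)
  finally show ?case using 4(1)[OF I0] 4(2)[OF I'] by (simp add: sum_deg_opt_cons)
qed

text \<open>The coefficient of V \<otimes> W in the coproduct of \<open>T\<close>, expressed through
  \<open>restr\<close>; \<open>card_N\<close> identifies it with the cardinality in the shuffle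
  product.\<close>

definition split_count :: "prt option \<Rightarrow> prt option \<Rightarrow> prt \<Rightarrow> nat" where
  "split_count V W T = card {I \<in> Pow (leaves (graph T)).
     (restr T I, restr T (leaves (graph T) - I)) = (V, W)}"

text \<open>The corresponding coefficient for the product of the coproducts of the trees, before
  anything is grafted.\<close>

definition forest_split_count :: "prt list \<Rightarrow> prt list \<Rightarrow> prt list \<Rightarrow> nat" where
  "forest_split_count vs ws Ts = card {I \<in> Pow (forest_leaves Ts).
     (restrs Ts I, restrs Ts (forest_leaves Ts - I)) = (vs, ws)}"

text \<open>The leaves of \<open>T\<close> are distributed between the two parts, so degrees add.
  This grading is what makes the sums over trees finite.\<close>

lemma split_count_eq_0:
  assumes "deg T \<noteq> opt_deg V + opt_deg W"
  shows "split_count V W T = 0"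
proof -
  have "opt_deg (restr T I) + opt_deg (restr T (leaves (graph T) - I)) = deg T"
    if "I \<subseteq> leaves (graph T)" for I
  proof -
    have "opt_deg (restr T I) + opt_deg (restr T (leaves (graph T) - I)) =
        card I + card (leaves (graph T) - I)"
      using that by (simp add: opt_deg_restr)
    also have "\<dots> = deg T"
      using that finite_leaves[of T] by (simp add: deg_def card_Diff_subset finite_subset card_mono)
    finally show ?thesis .
  qed
  then have "{I \<in> Pow (leaves (graph T)). (restr T I, restr T (leaves (graph T) - I)) = (V, W)} = {}"
    using assms by auto
  then show ?thesis unfolding split_count_def by (simp only: card.empty)
qed

lemma forest_split_count_eq_0:
  assumes "sum_list (map deg Ts) \<noteq> sum_list (map deg vs) + sum_list (map deg ws)"
  shows "forest_split_count vs ws Ts = 0"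
proof -
  have "sum_list (map deg (restrs Ts I)) + sum_list (map deg (restrs Ts (forest_leaves Ts - I))) =
      sum_list (map deg Ts)" if "I \<subseteq> forest_leaves Ts" for I
  proof -
    have "sum_list (map deg (restrs Ts I)) + sum_list (map deg (restrs Ts (forest_leaves Ts - I))) =
        card I + card (forest_leaves Ts - I)"
      using that by (simp add: opt_deg_restr)
    also have "\<dots> = card (forest_leaves Ts)"
      using that finite_forest_leaves[of Ts] by (simp add: card_Diff_subset finite_subset card_mono)
    finally show ?thesis by (simp add: card_forest_leaves)
  qed
  then have "{I \<in> Pow (forest_leaves Ts).
      (restrs Ts I, restrs Ts (forest_leaves Ts - I)) = (vs, ws)} = {}"
    using assms by auto
  then show ?thesis unfolding forest_split_count_def by (simp only: card.empty)
qed

text \<open>At most two forests: a tree of arity at least 2 comes from its branches and from itself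
  as a one-tree forest. The latter is the source of the terms with m = 1.\<close>

definition ungraft :: "prt option \<Rightarrow> prt list set" where
  "ungraft V = {vs. graft vs = V}"

lemma ungraft_simps:
  "ungraft None = {[]}" "ungraft (Some Leaf) = {[Leaf]}"
  "ungraft (Some (Graft v1 v2 vs)) = {[Graft v1 v2 vs], v1 # v2 # vs}"
proof -
  have "graft us = None \<longleftrightarrow> us = []" "graft us = Some Leaf \<longleftrightarrow> us = [Leaf]"
    "graft us = Some (Graft v1 v2 vs) \<longleftrightarrow> us = [Graft v1 v2 vs] \<or> us = v1 # v2 # vs" for us
    by (cases us rule: graft.cases; auto)+
  then show "ungraft None = {[]}" "ungraft (Some Leaf) = {[Leaf]}"
    "ungraft (Some (Graft v1 v2 vs)) = {[Graft v1 v2 vs], v1 # v2 # vs}"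
    by (auto simp: ungraft_def)
qed

lemma finite_ungraft: "finite (ungraft V)"
proof (cases V)
  case (Some v)
  then show ?thesis by (cases v) (auto simp: ungraft_simps)
qed (simp add: ungraft_simps)

text \<open>Both restrictions of a grafting are graftings of restricted forests, so its splittings
  can be sorted by the two forests obtained.\<close>

lemma split_count_Graft:
  "split_count V W (Graft T1 T2 Ts) =
     (\<Sum>(vs, ws)\<in>ungraft V \<times> ungraft W. forest_split_count vs ws (T1 # T2 # Ts))"
proof -
  let ?L = "forest_leaves (T1 # T2 # Ts)"
  let ?r = "restrs (T1 # T2 # Ts)"
  have "split_count V W (Graft T1 T2 Ts) =
      card {I \<in> Pow ?L. (?r I, ?r (?L - I)) \<in> ungraft V \<times> ungraft W}"
    unfolding split_count_def leaves_Graft restr.simps by (simp add: ungraft_def del: restrs.simps)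
  also have "\<dots> = (\<Sum>s\<in>ungraft V \<times> ungraft W. card {I \<in> Pow ?L. (?r I, ?r (?L - I)) = s})"
    by (rule card_fibres) (simp_all add: finite_forest_leaves finite_ungraft del: restrs.simps)
  also have "\<dots> = (\<Sum>(vs, ws)\<in>ungraft V \<times> ungraft W. forest_split_count vs ws (T1 # T2 # Ts))"
    by (intro sum.cong refl) (auto simp: forest_split_count_def simp del: restrs.simps)
  finally show ?thesis .
qed

text \<open>The first tree of a forest contributes either nothing or the first entry of the
  restricted forest; these are the resulting ways to split off its contribution.\<close>

definition heads :: "'a list \<Rightarrow> ('a option \<times> 'a list) set" where
  "heads vs = {(v, us). opt_cons v us = vs}"

lemma heads_Nil: "heads [] = {(None, [])}"
proof -
  have "opt_cons w us = [] \<longleftrightarrow> w = None \<and> us = []" for w :: "'a option" and us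
    by (cases w) auto
  then show ?thesis by (auto simp: heads_def)
qed

lemma heads_Cons: "heads (v # vs) = {(None, v # vs), (Some v, vs)}"
proof -
  have "opt_cons w us = v # vs \<longleftrightarrow> w = None \<and> us = v # vs \<or> w = Some v \<and> us = vs" for w us
    by (cases w) auto
  then show ?thesis by (auto simp: heads_def)
qed

lemma finite_heads: "finite (heads vs)"
  by (cases vs) (auto simp: heads_Nil heads_Cons)

lemma Cons_in_Cons_image: "i # p \<in> (#) k ` A \<longleftrightarrow> i = k \<and> p \<in> A"
  by auto

lemma Nil_notin_Cons_image: "[] \<notin> (#) k ` A"
  by auto

lemma parts_join:
  assumes "[] \<notin> J"
  shows "{p. 0 # p \<in> (#) 0 ` I \<union> shift ` J} = I"
    "{i # p | i p. Suc i # p \<in> (#) 0 ` I \<union> shift ` J} = J"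
proof -
  show "{p. 0 # p \<in> (#) 0 ` I \<union> shift ` J} = I"
    by (simp add: Cons_in_shift_image Cons_in_Cons_image)
  have "x \<in> {i # p | i p. Suc i # p \<in> (#) 0 ` I \<union> shift ` J} \<longleftrightarrow> x \<in> J" for x
    using assms by (cases x) (auto simp: Cons_in_shift_image Cons_in_Cons_image)
  then show "{i # p | i p. Suc i # p \<in> (#) 0 ` I \<union> shift ` J} = J" by blast
qed

lemma bij_betw_join:
  assumes "[] \<notin> B"
  shows "bij_betw (\<lambda>(I, J). (#) 0 ` I \<union> shift ` J) (Pow A \<times> Pow B) (Pow ((#) 0 ` A \<union> shift ` B))"
proof (rule bij_betw_byWitness[where f' = "\<lambda>I. ({p. 0 # p \<in> I}, {i # p | i p. Suc i # p \<in> I})"])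
  show "\<forall>a\<in>Pow A \<times> Pow B. (\<lambda>I. ({p. 0 # p \<in> I}, {i # p | i p. Suc i # p \<in> I}))
      ((\<lambda>(I, J). (#) 0 ` I \<union> shift ` J) a) = a"
  proof
    fix x assume "x \<in> Pow A \<times> Pow B"
    then obtain I J where x: "x = (I, J)" and "J \<subseteq> B" by auto
    then have J: "[] \<notin> J" using assms by blast
    show "(\<lambda>I. ({p. 0 # p \<in> I}, {i # p | i p. Suc i # p \<in> I}))
        ((\<lambda>(I, J). (#) 0 ` I \<union> shift ` J) x) = x"
      unfolding x prod.case parts_join[OF J] ..
  qed
  have Nil: "[] \<notin> (#) 0 ` A \<union> shift ` B" using assms by (auto simp: Nil_in_shift_image)
  show "\<forall>I\<in>Pow ((#) 0 ` A \<union> shift ` B). (\<lambda>(I, J). (#) 0 ` I \<union> shift ` J)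
      ({p. 0 # p \<in> I}, {i # p | i p. Suc i # p \<in> I}) = I"
  proof
    fix I assume "I \<in> Pow ((#) 0 ` A \<union> shift ` B)"
    then have "[] \<notin> I" using Nil by blast
    then show "(\<lambda>(I, J). (#) 0 ` I \<union> shift ` J) ({p. 0 # p \<in> I}, {i # p | i p. Suc i # p \<in> I}) = I"
      unfolding prod.case by (rule decompose_Cons[symmetric])
  qed
  show "(\<lambda>(I, J). (#) 0 ` I \<union> shift ` J) ` (Pow A \<times> Pow B) \<subseteq> Pow ((#) 0 ` A \<union> shift ` B)"
    by auto
  show "(\<lambda>I. ({p. 0 # p \<in> I}, {i # p | i p. Suc i # p \<in> I})) ` Pow ((#) 0 ` A \<union> shift ` B)
      \<subseteq> Pow A \<times> Pow B"
  proof (rule image_subsetI)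
    fix I assume "I \<in> Pow ((#) 0 ` A \<union> shift ` B)"
    then have I: "I \<subseteq> (#) 0 ` A \<union> shift ` B" by simp
    have "p \<in> A" if "0 # p \<in> I" for p
      using subsetD[OF I that] by (simp add: Cons_in_shift_image Cons_in_Cons_image)
    moreover have "i # p \<in> B" if "Suc i # p \<in> I" for i p
      using subsetD[OF I that] by (simp add: Cons_in_shift_image Cons_in_Cons_image)
    ultimately show "({p. 0 # p \<in> I}, {i # p | i p. Suc i # p \<in> I}) \<in> Pow A \<times> Pow B"
      by auto
  qed
qed

lemma restrs_join:
  assumes "[] \<notin> J"
  shows "restrs (T # Ts) ((#) 0 ` I \<union> shift ` J) = opt_cons (restr T I) (restrs Ts J)"
  unfolding restrs.simps parts_join[OF assms] ..

text \<open>Multiplicativity of the coproduct: a set of leaves of the forest is an independent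
  choice in the first tree and in the rest, and complements are taken separately.\<close>

lemma forest_split_count_Cons:
  "forest_split_count vs ws (T # Ts) =
     (\<Sum>((v, vs'), (w, ws'))\<in>heads vs \<times> heads ws. split_count v w T * forest_split_count vs' ws' Ts)"
proof -
  let ?A = "leaves (graph T)" and ?B = "forest_leaves Ts"
  let ?L = "(#) 0 ` ?A \<union> shift ` ?B"
  define j where "j = (\<lambda>(I, J). (#) 0 ` I \<union> shift ` J)"
  define r where "r = (\<lambda>(I, J). ((restr T I, restrs Ts J), (restr T (?A - I), restrs Ts (?B - J))))"
  have bij: "bij_betw j (Pow ?A \<times> Pow ?B) (Pow ?L)"
    unfolding j_def by (rule bij_betw_join) (rule Nil_notin_forest_leaves)
  have iff: "(restrs (T # Ts) (j x), restrs (T # Ts) (?L - j x)) = (vs, ws) \<longleftrightarrow>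
      r x \<in> heads vs \<times> heads ws" if x: "x \<in> Pow ?A \<times> Pow ?B" for x
  proof -
    obtain I J where x': "x = (I, J)" "I \<subseteq> ?A" "J \<subseteq> ?B" using x by auto
    have B: "[] \<notin> ?B" by (rule Nil_notin_forest_leaves)
    then have J: "[] \<notin> J" "[] \<notin> ?B - J" using x' by auto
    have jx: "j x = (#) 0 ` I \<union> shift ` J" by (simp add: x' j_def)
    have "?L - j x = (#) 0 ` (?A - I) \<union> shift ` (?B - J)"
    proof -
      have "y \<in> ?L - j x \<longleftrightarrow> y \<in> (#) 0 ` (?A - I) \<union> shift ` (?B - J)" for y
      proof (cases y)
        case Nil
        show ?thesis unfolding Nil by (simp add: B Nil_in_shift_image Nil_notin_Cons_image)
      next
        case (Cons i p)
        show ?thesis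
        proof (cases i)
          case 0
          show ?thesis unfolding Cons 0 jx by (simp add: Cons_in_shift_image Cons_in_Cons_image)
        next
          case (Suc k)
          show ?thesis unfolding Cons Suc jx by (simp add: Cons_in_shift_image Cons_in_Cons_image)
        qed
      qed
      then show ?thesis by (rule set_eqI)
    qed
    then have "restrs (T # Ts) (?L - j x) = opt_cons (restr T (?A - I)) (restrs Ts (?B - J))"
      using restrs_join[OF J(2)] by metis
    moreover have "restrs (T # Ts) (j x) = opt_cons (restr T I) (restrs Ts J)"
      unfolding jx by (rule restrs_join[OF J(1)])
    ultimately show ?thesis by (simp add: x' r_def heads_def del: restrs.simps)
  qed
  have "forest_split_count vs ws (T # Ts) =
      card {I \<in> Pow ?L. (restrs (T # Ts) I, restrs (T # Ts) (?L - I)) = (vs, ws)}"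
    by (simp add: forest_split_count_def forest_leaves_Cons del: restrs.simps)
  also have "{I \<in> Pow ?L. (restrs (T # Ts) I, restrs (T # Ts) (?L - I)) = (vs, ws)} =
      j ` {x \<in> Pow ?A \<times> Pow ?B. r x \<in> heads vs \<times> heads ws}"
  proof -
    have "Pow ?L = j ` (Pow ?A \<times> Pow ?B)" using bij by (simp add: bij_betw_def)
    then have "{I \<in> Pow ?L. P I} = j ` {x \<in> Pow ?A \<times> Pow ?B. P (j x)}" for P by auto
    moreover have "{x \<in> Pow ?A \<times> Pow ?B. (restrs (T # Ts) (j x), restrs (T # Ts) (?L - j x)) = (vs, ws)} =
        {x \<in> Pow ?A \<times> Pow ?B. r x \<in> heads vs \<times> heads ws}"
      by (intro Collect_cong conj_cong refl iff)
    ultimately show ?thesis by (simp only:)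
  qed
  also have "card \<dots> = card {x \<in> Pow ?A \<times> Pow ?B. r x \<in> heads vs \<times> heads ws}"
    using bij by (intro card_image) (auto simp: bij_betw_def intro: inj_on_subset)
  also have "\<dots> = (\<Sum>s\<in>heads vs \<times> heads ws. card {x \<in> Pow ?A \<times> Pow ?B. r x = s})"
    by (rule card_fibres) (simp_all add: finite_leaves finite_forest_leaves finite_heads)
  also have "\<dots> = (\<Sum>((v, vs'), (w, ws'))\<in>heads vs \<times> heads ws.
      split_count v w T * forest_split_count vs' ws' Ts)"
  proof (intro sum.cong refl, clarify)
    fix v vs' w ws'
    have "{x \<in> Pow ?A \<times> Pow ?B. r x = ((v, vs'), (w, ws'))} =
        {I \<in> Pow ?A. (restr T I, restr T (?A - I)) = (v, w)} \<times>
        {J \<in> Pow ?B. (restrs Ts J, restrs Ts (?B - J)) = (vs', ws')}"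
      by (auto simp: r_def)
    then show "card {x \<in> Pow ?A \<times> Pow ?B. r x = ((v, vs'), (w, ws'))} =
        split_count v w T * forest_split_count vs' ws' Ts"
      by (simp only: card_cartesian_product split_count_def forest_split_count_def)
  qed
  finally show ?thesis .
qed


section \<open>The generic exponential is group-like\<close>

text \<open>The number c(m, k, l) of pairs A, B of sizes k and l covering {1..m}: choose A, then the
  complement of B, of size m - l, inside A. The guard excludes l > m, where truncated subtraction
  would give m - l = 0.\<close>

definition quasi_shuffles :: "nat \<Rightarrow> nat \<Rightarrow> nat \<Rightarrow> nat" where
  "quasi_shuffles m k l = (if l \<le> m then (m choose k) * (k choose (m - l)) else 0)"

lemma quasi_shuffles_0: "quasi_shuffles 0 k l = of_bool (k = 0 \<and> l = 0)"
  by (auto simp: quasi_shuffles_def)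

text \<open>A fixed element lies only in A, only in B or in both. It cannot lie in neither, whence
  the first equation.\<close>

lemma quasi_shuffles_Suc:
  "quasi_shuffles (Suc m) 0 0 = 0"
  "quasi_shuffles (Suc m) (Suc k) 0 = quasi_shuffles m k 0"
  "quasi_shuffles (Suc m) 0 (Suc l) = quasi_shuffles m 0 l"
  "quasi_shuffles (Suc m) (Suc k) (Suc l) =
     quasi_shuffles m k (Suc l) + quasi_shuffles m (Suc k) l + quasi_shuffles m k l"
proof -
  show "quasi_shuffles (Suc m) 0 0 = 0" "quasi_shuffles (Suc m) 0 (Suc l) = quasi_shuffles m 0 l"
    by (simp_all add: quasi_shuffles_def)
  show "quasi_shuffles (Suc m) (Suc k) 0 = quasi_shuffles m k 0"
    by (cases m k rule: linorder_cases) (simp_all add: quasi_shuffles_def binomial_eq_0)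
  consider "m < l" | "m = l" | d where "m = Suc (l + d)"
    by (metis less_imp_Suc_add linorder_neqE_nat)
  then show "quasi_shuffles (Suc m) (Suc k) (Suc l) =
     quasi_shuffles m k (Suc l) + quasi_shuffles m (Suc k) l + quasi_shuffles m k l"
    by cases (simp_all add: quasi_shuffles_def algebra_simps Suc_diff_le)
qed

lemma quasi_shuffles_eq_0: "k + l < m \<or> m < k \<or> m < l \<Longrightarrow> quasi_shuffles m k l = 0"
  by (auto simp: quasi_shuffles_def binomial_eq_0)

text \<open>For a natural number x this sorts pairs of subsets of an x-set by the size m of their
  union. In general, Vandermonde for x = (x - k) + k splits the second factor, with j elements
  outside the first subset and m = k + j; trinomial revision then merges the binomials. Terms with m
  > k + l vanish, so every larger bound \<open>n\<close> serves.\<close>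

lemma gbinomial_mult_gbinomial:
  fixes x :: "'a::field_char_0"
  assumes "k + l \<le> n"
  shows "(\<Sum>m\<le>n. (x gchoose m) * of_nat (quasi_shuffles m k l)) = (x gchoose k) * (x gchoose l)"
proof -
  have "(x gchoose l) = (\<Sum>j\<in>{0..l}. ((x - of_nat k) gchoose j) * (of_nat k gchoose (l - j)))"
    unfolding gbinomial_Vandermonde by simp
  then have "(x gchoose k) * (x gchoose l) =
      (\<Sum>j\<in>{0..l}. (x gchoose k) * ((x - of_nat k) gchoose j) * (of_nat k gchoose (l - j)))"
    by (simp add: sum_distrib_left mult.assoc)
  also have "\<dots> = (\<Sum>j\<in>{0..l}. (x gchoose (k + j)) * of_nat (quasi_shuffles (k + j) k l))"
  proof (intro sum.cong refl)
    fix j assume j: "j \<in> {0..l}"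
    have "(x gchoose (k + j)) * of_nat ((k + j) choose k) =
        (x gchoose k) * ((x - of_nat k) gchoose j)"
      using gbinomial_trinomial_revision[of k "k + j" x] by (simp add: binomial_gbinomial)
    moreover have "quasi_shuffles (k + j) k l = ((k + j) choose k) * (k choose (l - j))"
      using j binomial_symmetric[of "l - j" k] by (auto simp: quasi_shuffles_def binomial_eq_0)
    ultimately show "(x gchoose k) * ((x - of_nat k) gchoose j) * (of_nat k gchoose (l - j)) =
        (x gchoose (k + j)) * of_nat (quasi_shuffles (k + j) k l)"
      by (simp add: binomial_gbinomial[symmetric] mult.assoc[symmetric])
  qed
  also have "\<dots> = (\<Sum>m\<in>{k..k+l}. (x gchoose m) * of_nat (quasi_shuffles m k l))"
    by (rule sum.reindex_bij_witness[of _ "\<lambda>m. m - k" "\<lambda>j. k + j"]) auto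
  also have "\<dots> = (\<Sum>m\<le>n. (x gchoose m) * of_nat (quasi_shuffles m k l))"
    using assms by (intro sum.mono_neutral_left) (auto intro!: quasi_shuffles_eq_0)
  finally show ?thesis ..
qed

text \<open>Keeps the denominators of the recursion nonzero: q is an indeterminate, so its powers
  are told apart by their degrees as polynomials.\<close>

lemma q_power_neq:
  assumes "n \<noteq> 1"
  shows "q ^ n \<noteq> q"
proof
  assume "q ^ n = q"
  moreover have "q ^ n = Fract ([:0, 1:] ^ n) 1"
    by (induction n) (simp_all add: q_def One_fract_def)
  ultimately have "[:0, 1:] ^ n = ([:0, 1:] :: rat poly)"
    by (simp add: q_def eq_fract)
  then have "degree ([:0, 1:] ^ n :: rat poly) = 1" by simp
  then show False using assms by (simp add: degree_power_eq)
qed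

lemma finite_deg_less: "finite {T. deg T < n}"
proof (induction n)
  case (Suc n)
  \<comment> \<open>Lists with fewer than two entries give unspecified trees under
    \<open>?g\<close>; only a finite superset is wanted.\<close>
  let ?g = "\<lambda>Ts. Graft (Ts ! 0) (Ts ! 1) (drop 2 Ts)"
  have "{T. deg T < Suc n} \<subseteq>
      insert Leaf (?g ` {Ts. set Ts \<subseteq> {T. deg T < n} \<and> length Ts \<le> n})"
  proof
    fix T assume "T \<in> {T. deg T < Suc n}"
    then have T: "deg T \<le> n" by simp
    show "T \<in> insert Leaf (?g ` {Ts. set Ts \<subseteq> {T. deg T < n} \<and> length Ts \<le> n})"
    proof (cases T)
      case (Graft T1 T2 Ts)
      let ?Ts = "T1 # T2 # Ts"
      have "deg S < n" if "S \<in> set ?Ts" for S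
        using deg_subtree_less[OF that] T by (simp add: Graft deg_Graft)
      moreover have "length ?Ts \<le> n"
        using length_le_sum_deg[of ?Ts] T by (simp add: Graft deg_Graft)
      ultimately show ?thesis by (intro insertI2 image_eqI[of _ _ ?Ts]) (auto simp: Graft)
    qed simp
  qed
  then show ?case using Suc by (auto intro: finite_subset finite_lists_length_le)
qed simp

section \<open>Coefficients of forests and the functional equation\<close>

definition forest_coeff :: "prt list \<Rightarrow> ratfun" where
  "forest_coeff Ts = prod_list (map exp_coeff_prt Ts)"

lemma exp_coeff_simps: "exp_coeff None = 1" "exp_coeff (Some T) = exp_coeff_prt T"
  by (simp_all add: exp_coeff_def)

lemma forest_coeff_simps [simp]:
  "forest_coeff [] = 1" "forest_coeff (T # Ts) = exp_coeff_prt T * forest_coeff Ts"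
  by (simp_all add: forest_coeff_def)

lemma forest_coeff_opt_cons: "forest_coeff (opt_cons V vs) = exp_coeff V * forest_coeff vs"
  by (cases V) (simp_all add: exp_coeff_simps)

lemma exp_coeff_Graft:
  "(q ^ deg (Graft T1 T2 Ts) - q) * exp_coeff_prt (Graft T1 T2 Ts) =
     (q gchoose length (T1 # T2 # Ts)) * forest_coeff (T1 # T2 # Ts)"
proof -
  have "deg (Graft T1 T2 Ts) \<noteq> 1"
    using length_le_sum_deg[of "T1 # T2 # Ts"] unfolding deg_Graft by auto
  then have "q ^ deg (Graft T1 T2 Ts) - q \<noteq> 0" using q_power_neq by simp
  then show ?thesis by (simp add: forest_coeff_def)
qed

text \<open>The functional equation $EXP(q x) = EXP(x)^q$ of the generic exponential, coefficientwise.\<close>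

lemma exp_coeff_functional_equation:
  "(\<Sum>vs\<in>ungraft V. (q gchoose length vs) * forest_coeff vs) = q ^ opt_deg V * exp_coeff V"
proof (cases V)
  case None
  then show ?thesis by (simp add: ungraft_simps exp_coeff_simps)
next
  case (Some v)
  show ?thesis
  proof (cases v)
    case Leaf
    then show ?thesis by (simp add: Some ungraft_simps exp_coeff_simps deg_Leaf)
  next
    case (Graft v1 v2 vs)
    have "(\<Sum>vs\<in>ungraft V. (q gchoose length vs) * forest_coeff vs) =
        q * exp_coeff_prt v + (q gchoose length (v1 # v2 # vs)) * forest_coeff (v1 # v2 # vs)"
      unfolding Some Graft ungraft_simps by (subst sum.insert) simp_all
    also have "\<dots> = q ^ deg v * exp_coeff_prt v"
      using exp_coeff_Graft[of v1 v2 vs] unfolding Graft by (simp only: algebra_simps)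
    finally show ?thesis by (simp add: Some exp_coeff_simps)
  qed
qed

text \<open>The sum b(V, W) cut at degree \<open>n\<close>, complete once \<open>n\<close> exceeds
  the total degree of \<open>V\<close> and \<open>W\<close>. The empty tree is left out because
  branches of a grafting are nonempty; for \<open>V = W = None\<close> the value is therefore 0 and
  not 1.\<close>

definition shuffle_sum :: "nat \<Rightarrow> prt option \<Rightarrow> prt option \<Rightarrow> ratfun" where
  "shuffle_sum n V W = (\<Sum>T | deg T < n. exp_coeff_prt T * of_nat (split_count V W T))"

definition forest_shuffle_sum :: "nat \<Rightarrow> nat \<Rightarrow> prt list \<Rightarrow> prt list \<Rightarrow> ratfun" where
  "forest_shuffle_sum n m vs ws = (\<Sum>Ts | set Ts \<subseteq> {T. deg T < n} \<and> length Ts = m.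
     forest_coeff Ts * of_nat (forest_split_count vs ws Ts))"

lemma shuffle_sum_None: "shuffle_sum n None None = 0"
proof -
  have "split_count None None T = 0" for T
    using deg_pos[of T] by (intro split_count_eq_0) simp
  then show ?thesis by (simp add: shuffle_sum_def)
qed

lemma forest_shuffle_sum_0: "forest_shuffle_sum n 0 vs ws = of_bool (vs = [] \<and> ws = [])"
proof -
  have "{Ts. set Ts \<subseteq> {T. deg T < n} \<and> length Ts = 0} = {[]}" by auto
  moreover have "forest_split_count vs ws [] = of_bool (vs = [] \<and> ws = [])"
  proof -
    have "{I \<in> Pow {}. ([] :: prt list, [] :: prt list) = (vs, ws)} =
        (if vs = [] \<and> ws = [] then {{}} else {} :: nat list set set)" by auto
    then show ?thesis by (simp add: forest_split_count_def)
  qed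
  ultimately show ?thesis by (simp add: forest_shuffle_sum_def)
qed

text \<open>For each choice of heads, coefficient and count both factor into a part for the first
  tree and a part for the rest, so the two can be summed separately.\<close>

lemma forest_shuffle_sum_Suc:
  "forest_shuffle_sum n (Suc m) vs ws =
     (\<Sum>((v, vs'), (w, ws'))\<in>heads vs \<times> heads ws. shuffle_sum n v w * forest_shuffle_sum n m vs' ws')"
proof -
  let ?U = "{T. deg T < n}"
  let ?L = "\<lambda>m. {Ts. set Ts \<subseteq> ?U \<and> length Ts = m}"
  let ?f = "\<lambda>T Ts h. case h of ((v, vs'), (w, ws')) \<Rightarrow>
     (exp_coeff_prt T * of_nat (split_count v w T)) *
     (forest_coeff Ts * of_nat (forest_split_count vs' ws' Ts))"
  have "forest_shuffle_sum n (Suc m) vs ws =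
      (\<Sum>x\<in>?U \<times> ?L m. forest_coeff (fst x # snd x) * of_nat (forest_split_count vs ws (fst x # snd x)))"
    unfolding forest_shuffle_sum_def
    by (rule sum.reindex_bij_witness[of _ "\<lambda>x. fst x # snd x" "\<lambda>Ts. (hd Ts, tl Ts)"])
      (auto simp: length_Suc_conv)
  also have "\<dots> = (\<Sum>x\<in>?U \<times> ?L m. \<Sum>h\<in>heads vs \<times> heads ws. ?f (fst x) (snd x) h)"
    unfolding forest_split_count_Cons of_nat_sum sum_distrib_left
    by (intro sum.cong refl) (auto simp: mult_ac)
  also have "\<dots> = (\<Sum>h\<in>heads vs \<times> heads ws. \<Sum>x\<in>?U \<times> ?L m. ?f (fst x) (snd x) h)"
    by (rule sum.swap)
  also have "\<dots> = (\<Sum>((v, vs'), (w, ws'))\<in>heads vs \<times> heads ws.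
      shuffle_sum n v w * forest_shuffle_sum n m vs' ws')"
    by (intro sum.cong refl)
      (auto simp: shuffle_sum_def forest_shuffle_sum_def sum_product sum.cartesian_product
        case_prod_beta)
  finally show ?thesis .
qed

lemma length_le_add_deg:
  "length vs + length ws \<le> sum_list (map deg vs) + sum_list (map deg ws)"
  by (intro add_mono length_le_sum_deg)

text \<open>The hypothesis \<open>IH\<close> covers total degrees below \<open>n\<close> only. Each
  of the m positions must use degree at least 1, so out of a total degree N a single position can
  use at most N - (m - 1), and the second assumption says that this is below \<open>n\<close>. It
  holds for N = n as soon as m \<ge> 2, the range of the recursion.\<close>

lemma forest_shuffle_sum_eq:
  assumes IH: "\<And>V W. 0 < opt_deg V + opt_deg W \<Longrightarrow> opt_deg V + opt_deg W < n \<Longrightarrow>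
    shuffle_sum n V W = exp_coeff V * exp_coeff W"
    and "sum_list (map deg vs) + sum_list (map deg ws) + 2 \<le> n + m"
  shows "forest_shuffle_sum n m vs ws =
    of_nat (quasi_shuffles m (length vs) (length ws)) * (forest_coeff vs * forest_coeff ws)"
  using assms(2)
proof (induction m arbitrary: vs ws)
  case 0
  then show ?case by (auto simp: forest_shuffle_sum_0 quasi_shuffles_0)
next
  case (Suc m)
  have head: "shuffle_sum n v w * forest_shuffle_sum n m vs' ws' =
      of_bool (v \<noteq> None \<or> w \<noteq> None) * of_nat (quasi_shuffles m (length vs') (length ws')) *
      (forest_coeff vs * forest_coeff ws)"
    if v: "opt_cons v vs' = vs" and w: "opt_cons w ws' = ws" for v vs' w ws'
  proof (cases "v = None \<and> w = None")
    case True
    then show ?thesis by (simp add: shuffle_sum_None)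
  next
    case False
    then have pos: "0 < opt_deg v + opt_deg w" using opt_deg_eq_0 by auto
    have deg: "sum_list (map deg vs) + sum_list (map deg ws) =
        opt_deg v + opt_deg w + (sum_list (map deg vs') + sum_list (map deg ws'))"
      using sum_deg_opt_cons[of v vs'] sum_deg_opt_cons[of w ws'] v w by simp
    have rest: "forest_shuffle_sum n m vs' ws' =
        of_nat (quasi_shuffles m (length vs') (length ws')) * (forest_coeff vs' * forest_coeff ws')"
      using Suc.prems pos deg by (intro Suc.IH) linarith
    have coeff: "forest_coeff vs * forest_coeff ws =
        exp_coeff v * exp_coeff w * (forest_coeff vs' * forest_coeff ws')"
      using forest_coeff_opt_cons[of v vs'] forest_coeff_opt_cons[of w ws'] v w by simp
    show ?thesis
    proof (cases "opt_deg v + opt_deg w < n")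
      case True
      then show ?thesis using False by (simp add: rest coeff IH[OF pos])
    next
      \<comment> \<open>A head using degree \<open>n\<close> or more leaves a degree below m for the
        other m positions; they cannot be covered, and both sides vanish.\<close>
      case ge: False
      have "length vs' + length ws' < m"
        using length_le_add_deg[of vs' ws'] Suc.prems ge deg pos by linarith
      then show ?thesis by (simp add: rest quasi_shuffles_eq_0)
    qed
  qed
  have "forest_shuffle_sum n (Suc m) vs ws = (\<Sum>((v, vs'), (w, ws'))\<in>heads vs \<times> heads ws.
      of_bool (v \<noteq> None \<or> w \<noteq> None) * of_nat (quasi_shuffles m (length vs') (length ws')) *
      (forest_coeff vs * forest_coeff ws))"
    unfolding forest_shuffle_sum_Suc
    by (intro sum.cong refl) (auto simp: heads_def head)
  also have "\<dots> = of_nat (quasi_shuffles (Suc m) (length vs) (length ws)) *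
      (forest_coeff vs * forest_coeff ws)"
    \<comment> \<open>The heads whose entries are not both \<open>None\<close> match the summands in
      \<open>quasi_shuffles_Suc\<close>.\<close>
    by (cases vs; cases ws)
      (simp_all add: heads_Nil heads_Cons quasi_shuffles_Suc sum.cartesian_product[symmetric] algebra_simps)
  finally show ?case .
qed

section \<open>Recursion and induction on the total degree\<close>

lemma deg_eq_1: "deg T = 1 \<longleftrightarrow> T = Leaf"
proof (cases T)
  case (Graft T1 T2 Ts)
  then show ?thesis using length_le_sum_deg[of "T1 # T2 # Ts"] unfolding Graft deg_Graft by auto
qed (simp add: deg_Leaf)

lemma split_count_Leaf:
  "split_count (Some Leaf) None Leaf = 1" "split_count None (Some Leaf) Leaf = 1"
proof -
  have "{I \<in> Pow {[]}. (restr Leaf I, restr Leaf ({[]} - I)) = (Some Leaf, None)} = {{[]}}"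
    "{I \<in> Pow {[]}. (restr Leaf I, restr Leaf ({[]} - I)) = (None, Some Leaf)} = {{}}"
    by (auto split: if_splits)
  then show "split_count (Some Leaf) None Leaf = 1" "split_count None (Some Leaf) Leaf = 1"
    by (simp_all add: split_count_def leaves_Leaf)
qed

lemma shuffle_sum_mono:
  assumes "opt_deg V + opt_deg W < n" "n \<le> k"
  shows "shuffle_sum k V W = shuffle_sum n V W"
  unfolding shuffle_sum_def using assms
  by (intro sum.mono_neutral_right) (auto simp: finite_deg_less split_count_eq_0)

text \<open>Trees of degree n \<ge> 2 are graftings and correspond to their lists of branches;
  multiplying by the denominator of a(T) leaves a binomial times a product over the
  branches.\<close>

lemma shuffle_sum_recursion:
  assumes n: "opt_deg V + opt_deg W = n" "n \<ge> 2"
  shows "(q ^ n - q) * shuffle_sum (Suc n) V W =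
    (\<Sum>m\<in>{2..n}. (q gchoose m) * (\<Sum>(vs, ws)\<in>ungraft V \<times> ungraft W. forest_shuffle_sum n m vs ws))"
proof -
  let ?D = "{T. deg T = n}"
  let ?L = "\<lambda>m. {Ts. set Ts \<subseteq> {T. deg T < n} \<and> length Ts = m}"
  let ?X = "\<Union>m\<in>{2..n}. ?L m"
  define g where "g = (\<lambda>Ts. (q gchoose length Ts) * (forest_coeff Ts *
    (\<Sum>(vs, ws)\<in>ungraft V \<times> ungraft W. of_nat (forest_split_count vs ws Ts))))"
  have finL: "finite (?L m)" for m using finite_lists_length_eq[OF finite_deg_less] by simp
  have shape: "\<exists>T1 T2 Ts. T = Graft T1 T2 Ts" if "deg T = n" for T
    using that n by (cases T) (auto simp: deg_Leaf)
  have "shuffle_sum (Suc n) V W = (\<Sum>T\<in>?D. exp_coeff_prt T * of_nat (split_count V W T))"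
    unfolding shuffle_sum_def using n
    by (intro sum.mono_neutral_right) (auto simp: finite_deg_less split_count_eq_0)
  then have "(q ^ n - q) * shuffle_sum (Suc n) V W =
      (\<Sum>T\<in>?D. (q ^ n - q) * exp_coeff_prt T * of_nat (split_count V W T))"
    by (simp add: sum_distrib_left mult.assoc)
  also have "\<dots> = (\<Sum>T\<in>?D. g (subtrees T))"
  proof (intro sum.cong refl)
    fix T assume "T \<in> ?D"
    then obtain T1 T2 Ts where T: "T = Graft T1 T2 Ts" and deg: "deg (Graft T1 T2 Ts) = n"
      using shape by blast
    have "(q ^ n - q) * exp_coeff_prt T = (q gchoose length (subtrees T)) * forest_coeff (subtrees T)"
      using exp_coeff_Graft[of T1 T2 Ts] unfolding T deg by simp
    moreover have "of_nat (split_count V W T) =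
        (\<Sum>(vs, ws)\<in>ungraft V \<times> ungraft W. of_nat (forest_split_count vs ws (subtrees T)) :: ratfun)"
      unfolding T split_count_Graft of_nat_sum by (simp add: case_prod_beta)
    ultimately show "(q ^ n - q) * exp_coeff_prt T * of_nat (split_count V W T) = g (subtrees T)"
      by (simp add: g_def mult.assoc)
  qed
  also have "\<dots> = (\<Sum>Ts\<in>subtrees ` ?D. g Ts)"
    by (subst sum.reindex) (auto intro: inj_onI subtrees_inject)
  \<comment> \<open>The index set grows to all lists of 2 to n trees of degree below n, as
    \<open>forest_shuffle_sum\<close> requires. The added lists have the wrong total degree, so
    their splitting counts are 0.\<close>
  also have "\<dots> = (\<Sum>Ts\<in>?X. g Ts)"
  proof (rule sum.mono_neutral_left)
    show "finite ?X" using finL by blast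
    show "subtrees ` ?D \<subseteq> ?X"
    proof (rule image_subsetI)
      fix T assume "T \<in> ?D"
      then obtain T1 T2 Ts where T: "T = Graft T1 T2 Ts"
        and deg: "sum_list (map deg (T1 # T2 # Ts)) = n"
        using shape[of T] by (auto simp: deg_Graft)
      have "length (T1 # T2 # Ts) \<in> {2..n}" using length_le_sum_deg[of "T1 # T2 # Ts"] deg by simp
      moreover have "set (T1 # T2 # Ts) \<subseteq> {T. deg T < n}"
        using deg_subtree_less[of _ "T1 # T2 # Ts"] deg by (simp del: list.set sum_list.Cons list.map) blast
      ultimately show "subtrees T \<in> ?X" unfolding T by auto
    qed
    show "\<forall>Ts\<in>?X - subtrees ` ?D. g Ts = 0"
    proof
      fix Ts assume Ts: "Ts \<in> ?X - subtrees ` ?D"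
      then have "length Ts \<ge> 2" by auto
      then obtain T1 T2 Us where eq: "Ts = T1 # T2 # Us"
        by (metis One_nat_def Suc_1 Suc_le_length_iff)
      then have "Ts = subtrees (Graft T1 T2 Us)" by simp
      then have "deg (Graft T1 T2 Us) \<noteq> n" using Ts by blast
      then have "sum_list (map deg Ts) \<noteq> n" by (simp add: deg_Graft eq)
      then have "forest_split_count vs ws Ts = 0" if "vs \<in> ungraft V" "ws \<in> ungraft W" for vs ws
        using that n(1) opt_deg_graft[of vs] opt_deg_graft[of ws]
        by (intro forest_split_count_eq_0) (auto simp: ungraft_def)
      then have "(\<Sum>(vs, ws)\<in>ungraft V \<times> ungraft W. of_nat (forest_split_count vs ws Ts)) = (0 :: ratfun)"
        by (intro sum.neutral) auto
      then show "g Ts = 0" by (simp add: g_def)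
    qed
  qed
  also have "\<dots> = (\<Sum>m\<in>{2..n}. \<Sum>Ts\<in>?L m. g Ts)"
    using finL by (intro sum.UNION_disjoint) auto
  also have "\<dots> = (\<Sum>m\<in>{2..n}. (q gchoose m) *
      (\<Sum>(vs, ws)\<in>ungraft V \<times> ungraft W. forest_shuffle_sum n m vs ws))"
  proof (intro sum.cong refl)
    fix m assume "m \<in> {2..n}"
    have "(\<Sum>Ts\<in>?L m. g Ts) = (q gchoose m) * (\<Sum>Ts\<in>?L m.
        \<Sum>h\<in>ungraft V \<times> ungraft W. forest_coeff Ts * of_nat (forest_split_count (fst h) (snd h) Ts))"
      by (simp add: g_def sum_distrib_left case_prod_beta)
    also have "\<dots> = (q gchoose m) * (\<Sum>h\<in>ungraft V \<times> ungraft W.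
        forest_shuffle_sum n m (fst h) (snd h))"
      unfolding forest_shuffle_sum_def by (subst sum.swap) (rule refl)
    finally show "(\<Sum>Ts\<in>?L m. g Ts) = (q gchoose m) *
        (\<Sum>(vs, ws)\<in>ungraft V \<times> ungraft W. forest_shuffle_sum n m vs ws)"
      by (simp add: case_prod_beta)
  qed
  finally show ?thesis .
qed

text \<open>Evaluates the term m = 1: c(1, k, l) vanishes for k > 1 or l > 1, which leaves only
  \<open>V\<close> and \<open>W\<close> as forests of at most one tree. For
  \<open>V = W = None\<close> the sum would be c(1, 0, 0) = 0, hence the assumption.\<close>

lemma sum_quasi_shuffles_1:
  assumes "V \<noteq> None \<or> W \<noteq> None"
  shows "(\<Sum>(vs, ws)\<in>ungraft V \<times> ungraft W.
      of_nat (quasi_shuffles 1 (length vs) (length ws)) * (forest_coeff vs * forest_coeff ws)) =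
    exp_coeff V * exp_coeff W"
proof -
  let ?f = "\<lambda>(vs, ws). of_nat (quasi_shuffles 1 (length vs) (length ws)) *
    (forest_coeff vs * forest_coeff ws)"
  let ?h = "(opt_cons V [], opt_cons W [])"
  have single: "opt_cons V [] \<in> ungraft V" for V by (cases V) (auto simp: ungraft_def)
  have other: "length vs \<ge> 2" if "vs \<in> ungraft V" "vs \<noteq> opt_cons V []" for vs V
    using that by (cases vs rule: graft.cases) (auto simp: ungraft_def)
  have "(\<Sum>h\<in>ungraft V \<times> ungraft W. ?f h) = (\<Sum>h\<in>{?h}. ?f h)"
  proof (rule sum.mono_neutral_right)
    show "\<forall>h\<in>ungraft V \<times> ungraft W - {?h}. ?f h = 0"
    proof
      fix h assume "h \<in> ungraft V \<times> ungraft W - {?h}"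
      then obtain vs ws where h: "h = (vs, ws)" "vs \<in> ungraft V" "ws \<in> ungraft W" "(vs, ws) \<noteq> ?h"
        by auto
      from h have "1 < length vs \<or> 1 < length ws" using other[of vs V] other[of ws W] by auto
      then have "quasi_shuffles 1 (length vs) (length ws) = 0" by (intro quasi_shuffles_eq_0) auto
      then show "?f h = 0" by (simp add: h)
    qed
  qed (auto simp: finite_ungraft single)
  also have "\<dots> = exp_coeff V * exp_coeff W"
    using assms by (cases V; cases W) (auto simp: exp_coeff_simps quasi_shuffles_def)
  finally show ?thesis .
qed

lemma shuffle_sum_eq:
  assumes "0 < opt_deg V + opt_deg W" "opt_deg V + opt_deg W < n"
  shows "shuffle_sum n V W = exp_coeff V * exp_coeff W"
  using assms
proof (induction n arbitrary: V W)
  case 0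
  then show ?case by simp
next
  case (Suc n)
  consider "opt_deg V + opt_deg W < n" | "opt_deg V + opt_deg W = n" "n = 1"
    | "opt_deg V + opt_deg W = n" "n \<ge> 2"
    using Suc.prems by linarith
  then show ?case
  proof cases
    case 1
    then show ?thesis using Suc.IH[OF Suc.prems(1) 1] shuffle_sum_mono[OF 1, of "Suc n"] by simp
  next
    \<comment> \<open>Here q^n - q is 0 and the recursion gives no information; the only tree in
      range is \<open>Leaf\<close>.\<close>
    case 2
    have "{T. deg T < Suc n} = {Leaf}"
    proof -
      have "deg T < Suc n \<longleftrightarrow> T = Leaf" for T
        using deg_pos[of T] deg_eq_1[of T] 2 by linarith
      then show ?thesis by auto
    qed
    then have sum: "shuffle_sum (Suc n) V W = of_nat (split_count V W Leaf)"
      by (simp add: shuffle_sum_def)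
    have "opt_deg V = 1 \<and> W = None \<or> V = None \<and> opt_deg W = 1"
      using 2 unfolding opt_deg_eq_0[symmetric] by linarith
    then have "V = Some Leaf \<and> W = None \<or> V = None \<and> W = Some Leaf"
      by (cases V; cases W) (auto simp: deg_eq_1[unfolded One_nat_def])
    then show ?thesis unfolding sum by (auto simp: split_count_Leaf exp_coeff_simps)
  next
    case 3
    let ?U = "ungraft V \<times> ungraft W"
    let ?c = "\<lambda>m h. of_nat (quasi_shuffles m (length (fst h)) (length (snd h))) *
      (forest_coeff (fst h) * forest_coeff (snd h))"
    let ?s = "\<lambda>m. (q gchoose m) * (\<Sum>h\<in>?U. ?c m h)"
    have deg: "sum_list (map deg (fst h)) + sum_list (map deg (snd h)) = n" if "h \<in> ?U" for h
      using that 3(1) opt_deg_graft[of "fst h"] opt_deg_graft[of "snd h"]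
      by (auto simp: ungraft_def)
    have F: "forest_shuffle_sum n m (fst h) (snd h) = ?c m h" if "m \<in> {2..n}" "h \<in> ?U" for m h
      using Suc.IH deg[OF that(2)] that(1) by (intro forest_shuffle_sum_eq) auto
    have rec: "(q ^ n - q) * shuffle_sum (Suc n) V W = (\<Sum>m\<in>{2..n}. ?s m)"
      unfolding shuffle_sum_recursion[OF 3] case_prod_beta
      by (intro sum.cong refl arg_cong2[where f = "(*)"] F)
    \<comment> \<open>The recursion starts at m = 2. Adding m = 0, which contributes 0, and m = 1,
      which contributes q a(V) a(W), makes the binomial identity applicable.\<close>
    have split: "(\<Sum>m\<le>n. ?s m) = ?s 0 + ?s 1 + (\<Sum>m\<in>{2..n}. ?s m)"
    proof -
      have "{..n} = insert 0 (insert 1 {2..n})" using 3(2) by auto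
      then show ?thesis by (simp add: add.assoc)
    qed
    have s0: "?s 0 = 0"
    proof -
      have "?c 0 h = 0" if "h \<in> ?U" for h using deg[OF that] 3(2) by (auto simp: quasi_shuffles_0)
      then have "(\<Sum>h\<in>?U. ?c 0 h) = 0" by (intro sum.neutral ballI)
      then show ?thesis by simp
    qed
    have s1: "?s 1 = q * (exp_coeff V * exp_coeff W)"
    proof -
      have "V \<noteq> None \<or> W \<noteq> None" using Suc.prems(1) by auto
      then show ?thesis using sum_quasi_shuffles_1[of V W] by (simp add: case_prod_beta)
    qed
    \<comment> \<open>After exchanging the sums, the sum over m becomes a product of two binomials,
      and what remains factors into the functional equations for \<open>V\<close> and for
      \<open>W\<close>.\<close>
    have total: "(\<Sum>m\<le>n. ?s m) = q ^ n * (exp_coeff V * exp_coeff W)"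
    proof -
      have "(\<Sum>m\<le>n. ?s m) = (\<Sum>h\<in>?U. (forest_coeff (fst h) * forest_coeff (snd h)) *
          (\<Sum>m\<le>n. (q gchoose m) * of_nat (quasi_shuffles m (length (fst h)) (length (snd h)))))"
        by (simp add: sum_distrib_left mult_ac sum.swap[of _ "{..n}"])
      also have "\<dots> = (\<Sum>h\<in>?U. ((q gchoose length (fst h)) * forest_coeff (fst h)) *
          ((q gchoose length (snd h)) * forest_coeff (snd h)))"
      proof (intro sum.cong refl)
        fix h assume "h \<in> ?U"
        then have "length (fst h) + length (snd h) \<le> n"
          using deg length_le_add_deg[of "fst h" "snd h"] by simp
        then show "(forest_coeff (fst h) * forest_coeff (snd h)) *
          (\<Sum>m\<le>n. (q gchoose m) * of_nat (quasi_shuffles m (length (fst h)) (length (snd h)))) =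
          ((q gchoose length (fst h)) * forest_coeff (fst h)) *
          ((q gchoose length (snd h)) * forest_coeff (snd h))"
          by (simp only: gbinomial_mult_gbinomial mult_ac)
      qed
      also have "\<dots> = (q ^ opt_deg V * exp_coeff V) * (q ^ opt_deg W * exp_coeff W)"
        unfolding exp_coeff_functional_equation[symmetric] sum_product sum.cartesian_product
        by (simp add: case_prod_beta)
      finally show ?thesis by (simp add: 3(1)[symmetric] power_add mult_ac)
    qed
    have "(q ^ n - q) * shuffle_sum (Suc n) V W = (\<Sum>m\<le>n. ?s m) - ?s 1"
      unfolding rec split s0 by (simp only: add_0 add_diff_cancel_left')
    then have "(q ^ n - q) * shuffle_sum (Suc n) V W = (q ^ n - q) * (exp_coeff V * exp_coeff W)"
      by (simp only: total s1 left_diff_distrib)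
    moreover have "q ^ n - q \<noteq> 0" using q_power_neq[of n] 3(2) by simp
    ultimately show ?thesis by simp
  qed
qed

section \<open>Back to the shuffle product\<close>

lemma card_N:
  "card (N V W None) = of_bool (V = None \<and> W = None)"
  "card (N V W (Some T)) = split_count V W T"
proof -
  have "N V W None = (if V = None \<and> W = None then {{}} else {})"
    by (auto simp: N_def leaf_set_def restricts_to_def)
  then show "card (N V W None) = of_bool (V = None \<and> W = None)" by simp
  have "N V W (Some T) =
      {I \<in> Pow (leaves (graph T)). (restr T I, restr T (leaves (graph T) - I)) = (V, W)}"
    by (auto simp: N_def leaf_set_def restricts_to_iff)
  then show "card (N V W (Some T)) = split_count V W T" by (simp add: split_count_def)
qed

lemma N_support: "{T. card (N V W T) \<noteq> 0} \<subseteq> insert None (Some ` {T. deg T < Suc (opt_deg V + opt_deg W)})"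
proof
  fix T assume T: "T \<in> {T. card (N V W T) \<noteq> 0}"
  show "T \<in> insert None (Some ` {T. deg T < Suc (opt_deg V + opt_deg W)})"
  proof (cases T)
    case (Some t)
    then have "deg t = opt_deg V + opt_deg W" using T split_count_eq_0 by (force simp: card_N)
    then show ?thesis using Some by simp
  qed simp
qed

text \<open>\<open>Sum_any\<close> defaults to 0 on infinite support, so reading off a coefficient
  rests on the finite bound in \<open>N_support\<close>.\<close>

lemma coeff_at_shuffle: "coeff_at T (shuffle V W) = of_nat (card (N V W T))"
proof -
  let ?S = "insert None (Some ` {T. deg T < Suc (opt_deg V + opt_deg W)})"
  have fin: "finite ?S" using finite_deg_less by simp
  have "{T. Poly_Mapping.single T (of_nat (card (N V W T)) :: ratfun) \<noteq> 0} \<subseteq> {T. card (N V W T) \<noteq> 0}"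
    using single_zero by (intro Collect_mono impI notI) simp
  then have "shuffle V W = (\<Sum>T\<in>?S. Poly_Mapping.single T (of_nat (card (N V W T))))"
    unfolding shuffle_def
    by (intro Sum_any.expand_superset[OF fin] subset_trans[OF _ N_support])
  then have "coeff_at T (shuffle V W) =
      (\<Sum>S\<in>?S. if S = T then of_nat (card (N V W S)) else 0)"
    by (simp add: coeff_at_def Poly_Mapping.lookup_sum lookup_single when_def)
  also have "\<dots> = (if T \<in> ?S then of_nat (card (N V W T)) else 0)"
    using fin by (rule sum.delta)
  also have "\<dots> = of_nat (card (N V W T))" using N_support[of V W] by auto
  finally show ?thesis .
qed

theorem corollary5p2:
  fixes V W :: "prt option"
  shows "exp_coeff V * exp_coeff W = (\<Sum>T. exp_coeff T * coeff_at T (shuffle V W))"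
proof -
  let ?n = "Suc (opt_deg V + opt_deg W)"
  let ?S = "{T. deg T < ?n}"
  let ?f = "\<lambda>T. exp_coeff T * of_nat (card (N V W T))"
  have "(\<Sum>T. ?f T) = (\<Sum>T\<in>insert None (Some ` ?S). ?f T)"
    using N_support[of V W] finite_deg_less by (intro Sum_any.expand_superset) auto
  also have "\<dots> = ?f None + (\<Sum>T\<in>?S. ?f (Some T))"
    using finite_deg_less by (simp add: image_iff sum.reindex)
  \<comment> \<open>The empty tree, left out of \<open>shuffle_sum\<close>, contributes exactly for
    \<open>V = W = None\<close>, where that sum is 0.\<close>
  also have "\<dots> = of_bool (V = None \<and> W = None) + shuffle_sum ?n V W"
    by (simp add: card_N exp_coeff_simps shuffle_sum_def)
  also have "\<dots> = exp_coeff V * exp_coeff W"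
  proof (cases "V = None \<and> W = None")
    case True
    then show ?thesis by (simp add: shuffle_sum_None exp_coeff_simps)
  next
    case False
    then have "0 < opt_deg V + opt_deg W" using opt_deg_eq_0 by auto
    then show ?thesis using False by (simp add: shuffle_sum_eq)
  qed
  finally show ?thesis by (simp add: coeff_at_shuffle)
qed

end
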